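(* Consider sequences $(p_i)_{i\in\mathbb{Z}}$, $(q_i)_{i\in\mathbb{Z}}$ of functions of a complex variable $z$ with $p_{-1}=z$, $p_0=q_0=1$, $q_1=z$, satisfying for all $i\in\mathbb{Z}$ the recurrence relations $$q_{i+1}'q_i-q_{i+1}q_i'=(3i+1)p_i,\qquad p_i'p_{i-1}-p_ip_{i-1}'=(6i-1)q_i^4. \qquad (R)$$ (1) For every solution of (R) with $p_{-1}=z$, $p_0=q_0=1$, $q_1=z$, all $p_i,q_i$ are polynomials, of degrees $$\deg p_i=i(3i+2),\qquad \deg q_i=\frac{i(3i-1)}{2},\qquad i\in\mathbb{Z}.$$ (2) For every solution of (R) with $p_{-1}=z$, $p_0=q_0=1$, $q_1=z$, $\{p_i,q_i\}_2=\{p_i,q_{i+1}\}_2=0$ for all $i\in\mathbb{Z}$. Moreover these provide all solutions: if $p,q$ are monic polynomials without multiple or common roots and $\{p,q\}_2=0$, then, modulo a translation of $z$, there are a solution $(p_i),(q_i)$ of (R) with $p_{-1}=z$, $p_0=q_0=1$, $q_1=z$ and an $i\in\mathbb{Z}$ such that $p=p_i,\ q=q_i$ or $p=p_i,\ q=q_{i+1}$. (3) For monic polynomials $p,q$ without multiple or common roots, both indefinite integrals $$\int\frac{p}{q^2}\,dz,\qquad\int\frac{q^4}{p^2}\,dz$$ are rational if and only if $\{p,q\}_2=0$, i.e. if and only if, modulo a translation of $z$, $p=p_i,\ q=q_i$ or $p=p_i,\ q=q_{i+1}$ for some $i\in\mathbb{Z}$ and some solution of (R) with $p_{-1}=z$,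 $p_0=q_0=1$, $q_1=z$. (4) Let $(p,q)$ be one of the pairs $(p_i,q_i)$ or $(p_i,q_{i+1})$, $i\in\mathbb{Z}$, from a solution of (R) with $p_{-1}=z$, $p_0=q_0=1$, $q_1=z$, such that $p,q$ have no multiple or common roots, and let $n=\deg p$, $m=\deg q$. Then the energy function $$E=\sum_{1\le i<j\le n+m}Q_iQ_j\log|z_i-z_j|,\qquad Q_i=1\ (1\le i\le n),\quad Q_i=-2\ (n+1\le i\le n+m),$$ has a critical point when $z_1,\dots,z_n$ are the zeros of $p$ and $z_{n+1},\dots,z_{n+m}$ are the zeros of $q$.
   Context: For polynomials $p,q$ in $z$, $$\{p,q\}_2:=p''q-4p'q'+4pq'',$$ where primes denote $d/dz$. The functions in the recurrence are taken to be meromorphic functions of $z\in\mathbb{C}$. Each step of the recurrence, upward or downward from the initial values $p_{-1}=z$, $p_0=q_0=1$, $q_1=z$, is a first-order linear differential equation for the next function and introduces an arbitrary integration constant, so there are many solutions $(p_i),(q_i)$. "Modulo a translation of $z$" means after replacing $p(z),q(z)$ by $p(z+c),q(z+c)$ for some $c\in\mathbb{C}$ (the same $c$ for both). An indefinite integral is called rational if the integrand has an antiderivative that is a rational function of $z$. A critical point of the real function $E$ of the complex variables $z_1,\dots,z_{n+m}$ is a point (with pairwise distinct $z_i$) at which all first-order real partial derivatives vanish. *)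

theory Defs
  imports "HOL-Complex_Analysis.Complex_Analysis"
begin

definition bracket2 :: "complex poly \<Rightarrow> complex poly \<Rightarrow> complex poly" where
  "bracket2 p q =
     pderiv (pderiv p) * q - 4 * pderiv p * pderiv q + 4 * p * pderiv (pderiv q)"

text \<open>
  A meromorphic function on the complex plane is represented by its canonical total function
  (\<^const>\<open>nicely_meromorphic_on\<close>: continuous off the poles, value 0 at the poles), so that
  two meromorphic functions coincide iff their representatives are equal. The recurrence
  relations are identities between meromorphic functions; since \<^const>\<open>deriv\<close> is unspecified
  at poles, they are required off a set without accumulation points.
\<close>

definition rec_solution ::
    "(int \<Rightarrow> complex \<Rightarrow> complex) \<Rightarrow> (int \<Rightarrow> complex \<Rightarrow> complex) \<Rightarrow> bool" where
  "rec_solution p q \<longleftrightarrow>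
     (\<forall>i. p i nicely_meromorphic_on UNIV) \<and> (\<forall>i. q i nicely_meromorphic_on UNIV) \<and>
     p (-1) = (\<lambda>z. z) \<and> p 0 = (\<lambda>z. 1) \<and> q 0 = (\<lambda>z. 1) \<and> q 1 = (\<lambda>z. z) \<and>
     (\<forall>i. eventually (\<lambda>z. deriv (q (i + 1)) z * q i z - q (i + 1) z * deriv (q i) z
                           = of_int (3 * i + 1) * p i z) (cosparse UNIV)) \<and>
     (\<forall>i. eventually (\<lambda>z. deriv (p i) z * p (i - 1) z - p i z * deriv (p (i - 1)) z
                           = of_int (6 * i - 1) * q i z ^ 4) (cosparse UNIV))"

definition solution_pair :: "complex poly \<Rightarrow> complex poly \<Rightarrow> bool" where
  "solution_pair P Q \<longleftrightarrow>
     (\<exists>p q i. rec_solution p q \<and>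
        (poly P = p i \<and> poly Q = q i \<or> poly P = p i \<and> poly Q = q (i + 1)))"

definition solution_pair_mod_translation :: "complex poly \<Rightarrow> complex poly \<Rightarrow> bool" where
  "solution_pair_mod_translation P Q \<longleftrightarrow>
     (\<exists>c. solution_pair (pcompose P [:c, 1:]) (pcompose Q [:c, 1:]))"

definition no_multiple_or_common_roots :: "complex poly \<Rightarrow> complex poly \<Rightarrow> bool" where
  "no_multiple_or_common_roots p q \<longleftrightarrow>
     rsquarefree p \<and> rsquarefree q \<and> \<not> (\<exists>z. poly p z = 0 \<and> poly q z = 0)"

text \<open>The integrand is the rational function \<open>N / D\<close>, its antiderivative \<open>A / B\<close>.\<close>

definition rational_integral :: "complex poly \<Rightarrow> complex poly \<Rightarrow> bool" where
  "rational_integral N D \<longleftrightarrow>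
     (\<exists>A B. B \<noteq> 0 \<and>
        (\<forall>z. poly D z \<noteq> 0 \<longrightarrow> poly B z \<noteq> 0 \<longrightarrow>
           ((\<lambda>w. poly A w / poly B w) has_field_derivative poly N z / poly D z) (at z)))"

definition charge :: "nat \<Rightarrow> nat \<Rightarrow> real" where
  "charge n i = (if i \<le> n then 1 else -2)"

definition energy :: "nat \<Rightarrow> nat \<Rightarrow> (nat \<Rightarrow> complex) \<Rightarrow> real" where
  "energy n m z =
     (\<Sum>j = 1..n + m. \<Sum>i = 1..<j. charge n i * charge n j * ln (cmod (z i - z j)))"

text \<open>
  Points of \<open>\<complex>\<^sup>N\<close> are given by the values of \<^typ>\<open>nat \<Rightarrow> complex\<close> at the indices
  \<open>1, \<dots>, N\<close>. The two derivatives are the partial derivatives with respect to the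
  real and the imaginary part of the \<open>k\<close>-th coordinate.
\<close>

definition critical_point :: "nat \<Rightarrow> ((nat \<Rightarrow> complex) \<Rightarrow> real) \<Rightarrow> (nat \<Rightarrow> complex) \<Rightarrow> bool" where
  "critical_point N E z \<longleftrightarrow>
     inj_on z {1..N} \<and>
     (\<forall>k\<in>{1..N}.
        ((\<lambda>t. E (z(k := z k + of_real t))) has_real_derivative 0) (at 0) \<and>
        ((\<lambda>t. E (z(k := z k + \<i> * of_real t))) has_real_derivative 0) (at 0))"

end

theory Submission
  imports Defs "HOL-Computational_Algebra.Fundamental_Theorem_Algebra"
begin

text \<open>
  Write \<open>W(f, g) = f' g - f g'\<close>. For fixed \<open>p\<close> the equation \<open>{p, q}\<^sub>2 = 0\<close> is a second-order linear
  equation for \<open>q\<close> whose Wronskians are the multiples of \<open>p\<close>, and for fixed \<open>q\<close> it is one for \<open>p\<close>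
  whose Wronskians are the multiples of \<open>q\<^sup>4\<close>. Hence each step of the recurrence replaces one of
  \<open>p, q\<close> by a second solution of the same equation and preserves the bracket.

  A step has a rational solution iff \<open>p / q\<^sup>2\<close>, respectively \<open>q\<^sup>4 / p\<^sup>2\<close>, has no residues. If
  \<open>p, q\<close> have no multiple or common roots, this follows from the vanishing of the bracket at the
  roots, and the solution is a polynomial. Along the recurrence multiple and common roots do occur, and then the vanishing of the
  bracket alone does not exclude residues. However, a generic choice of the integration constant
  keeps the roots simple and distinct, and solvability is a closed condition, so every pair along
  the recurrence is a limit of pairs with simple and distinct roots, which suffices. This works in
  both directions, so any pair as in (2) can also be followed down to \<open>(1, 1)\<close>; the degrees are
  determined by the leading coefficient of the bracket.
\<close>

section \<open>Wronskians of polynomials\<close>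

text \<open>Multiple and common roots cannot be avoided: the step from \<open>(1, z)\<close> gives
  \<open>p_1 = z^5 + c\<close>, and for \<open>c = 0\<close> the root is fivefold and shared with
  \<open>q_1 = z\<close>. One bracket serves both kinds of step because, when the roots are simple
  and distinct, its values at the roots of \<open>q\<close> and of \<open>p\<close> are, up to
  nonzero factors, the residues of \<open>p / q^2\<close> and \<open>q^4 / p^2\<close>. The same
  values are the forces in the statement on the energy. The factors \<open>3 * i + 1\<close> and
  \<open>6 * i - 1\<close> are the degree differences of neighbouring terms, which is what allows
  all terms to be monic. Away from index 0 every integration constant keeps the expected degree, so
  induction from index 0 controls all solutions. Towards index 0 only a suitable constant does, so a
  chain through a given pair has to be chosen. Such a chain has \<open>q_1 = z + c\<close> and
  \<open>p_{-1} = z + c'\<close> with unrelated constants, while one translation normalises only one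
  of them. As the pair lies on one side of index 0, only that half of the chain is kept and the
  other half is rebuilt from the same constant.\<close>

definition wronskian :: "complex poly \<Rightarrow> complex poly \<Rightarrow> complex poly" where
  "wronskian A B = pderiv A * B - A * pderiv B"

lemma wronskian_add_left: "wronskian (A + C) B = wronskian A B + wronskian C B"
  by (simp add: wronskian_def pderiv_add algebra_simps)

lemma wronskian_diff_left: "wronskian (A - C) B = wronskian A B - wronskian C B"
  by (simp add: wronskian_def pderiv_diff algebra_simps)

lemma wronskian_smult_left: "wronskian (smult c A) B = smult c (wronskian A B)"
  by (simp add: wronskian_def pderiv_smult smult_diff_right)

lemma wronskian_smult_right: "wronskian A (smult c B) = smult c (wronskian A B)"
  by (simp add: wronskian_def pderiv_smult smult_diff_right)

lemma wronskian_self [simp]: "wronskian A A = 0"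
  by (simp add: wronskian_def)

lemma wronskian_zero_left [simp]: "wronskian 0 A = 0"
  by (simp add: wronskian_def)

lemma wronskian_commute: "wronskian B A = - wronskian A B"
  by (simp add: wronskian_def algebra_simps)

section \<open>Degrees and leading coefficients of Wronskians\<close>

lemma coeff_mult_top:
  fixes p q :: "complex poly"
  assumes "degree p \<le> a" "degree q \<le> b"
  shows "coeff (p * q) (a + b) = coeff p a * coeff q b"
proof -
  have "coeff (p * q) (a + b) = (\<Sum>i\<le>a + b. coeff p i * coeff q (a + b - i))"
    by (simp add: coeff_mult)
  also have "\<dots> = (\<Sum>i\<in>{a}. coeff p i * coeff q (a + b - i))"
  proof (rule sum.mono_neutral_right)
    show "\<forall>i\<in>{..a + b} - {a}. coeff p i * coeff q (a + b - i) = 0"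
    proof
      fix i assume i: "i \<in> {..a + b} - {a}"
      show "coeff p i * coeff q (a + b - i) = 0"
      proof (cases "i < a")
        case True
        then have "coeff q (a + b - i) = 0" using assms by (intro coeff_eq_0) auto
        then show ?thesis by simp
      next
        case False
        then have "coeff p i = 0" using assms i by (intro coeff_eq_0) auto
        then show ?thesis by simp
      qed
    qed
  qed auto
  finally show ?thesis by simp
qed

lemma coeff_pderiv_mult_top:
  fixes p q :: "complex poly"
  assumes "degree p + degree q = Suc k"
  shows "coeff (pderiv p * q) k = of_nat (degree p) * lead_coeff p * lead_coeff q"
proof (cases "degree p")
  case 0
  then have "pderiv p = 0" by (simp add: pderiv_eq_0_iff)
  with 0 show ?thesis by simp
next
  case (Suc d)
  have "coeff (pderiv p * q) (d + degree q) = coeff (pderiv p) d * lead_coeff q"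
    by (rule coeff_mult_top) (simp_all add: degree_pderiv Suc)
  then show ?thesis using assms Suc by (simp add: coeff_pderiv)
qed

lemma coeff_wronskian_top:
  assumes "degree A + degree B = Suc k"
  shows "coeff (wronskian A B) k
    = (of_nat (degree A) - of_nat (degree B)) * lead_coeff A * lead_coeff B"
proof -
  have "coeff (A * pderiv B) k = of_nat (degree B) * lead_coeff B * lead_coeff A"
    using coeff_pderiv_mult_top[of B A k] assms by (simp add: add.commute mult.commute)
  then show ?thesis
    using coeff_pderiv_mult_top[of A B k] assms by (simp add: wronskian_def algebra_simps)
qed

lemma degree_pderiv_mult_less:
  fixes p q :: "complex poly"
  assumes "0 < degree p + degree q"
  shows "degree (pderiv p * q) < degree p + degree q"
proof (cases "degree p")
  case 0
  then have "pderiv p = 0" by (simp add: pderiv_eq_0_iff)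
  with assms show ?thesis by simp
next
  case (Suc d)
  then show ?thesis using degree_mult_le[of "pderiv p" q] by (simp add: degree_pderiv)
qed

lemma degree_wronskian_less:
  assumes "0 < degree A + degree B"
  shows "degree (wronskian A B) < degree A + degree B"
proof -
  have "degree (A * pderiv B) < degree A + degree B"
    using degree_pderiv_mult_less[of B A] assms by (simp add: mult.commute add.commute)
  then show ?thesis unfolding wronskian_def using degree_pderiv_mult_less[of A B] assms
    by (intro degree_diff_less)
qed

lemma degree_wronskian:
  assumes "A \<noteq> 0" "B \<noteq> 0" "degree A \<noteq> degree B"
  shows "Suc (degree (wronskian A B)) = degree A + degree B"
    and "lead_coeff (wronskian A B) = (of_nat (degree A) - of_nat (degree B)) * lead_coeff A * lead_coeff B"
proof -
  obtain k where k: "degree A + degree B = Suc k"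
    using assms(3) by (cases "degree A + degree B") auto
  have nz: "coeff (wronskian A B) k \<noteq> 0"
    using assms by (simp add: coeff_wronskian_top[OF k])
  have "degree (wronskian A B) = k"
    using le_degree[OF nz] degree_wronskian_less[of A B] k by simp
  then show "Suc (degree (wronskian A B)) = degree A + degree B"
    and "lead_coeff (wronskian A B) = (of_nat (degree A) - of_nat (degree B)) * lead_coeff A * lead_coeff B"
    using k coeff_wronskian_top[OF k] by auto
qed

text \<open>For equal degrees the top coefficient cancels, so the Wronskian loses a further degree.
  This later excludes equal degrees when the Wronskian is known to be large.\<close>

lemma degree_wronskian_same:
  assumes "degree A = degree B" "0 < degree B"
  shows "Suc (degree (wronskian A B)) < 2 * degree B"
proof -
  obtain k where k: "degree A + degree B = Suc k"
    using assms by (cases "degree A + degree B") auto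
  have z: "coeff (wronskian A B) k = 0"
    using assms by (simp add: coeff_wronskian_top[OF k])
  have "degree (wronskian A B) \<le> k"
    using degree_wronskian_less[of A B] k by simp
  moreover have "degree (wronskian A B) \<noteq> k"
  proof
    assume d: "degree (wronskian A B) = k"
    with z have "wronskian A B = 0" by (metis leading_coeff_0_iff)
    with d have "k = 0" by simp
    with k assms show False by simp
  qed
  ultimately show ?thesis using k assms by simp
qed

text \<open>Subtracting the multiple of \<open>B\<close> that kills the coefficient at
  \<open>degree B\<close> leaves a polynomial whose degree differs from that of \<open>B\<close>
  unless it is 0, and different degrees give a nonzero Wronskian. The explicit factor yields
  \<open>A = 0\<close> at once when that coefficient of \<open>A\<close> vanishes.\<close>

lemma wronskian_eq_0_imp:
  assumes "wronskian A B = 0" "B \<noteq> 0"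
  shows "A = smult (coeff A (degree B) / lead_coeff B) B"
proof -
  define C where "C = A - smult (coeff A (degree B) / lead_coeff B) B"
  have c0: "coeff C (degree B) = 0"
    using assms(2) by (simp add: C_def)
  have w: "wronskian C B = 0"
    by (simp add: C_def wronskian_diff_left wronskian_smult_left assms)
  have "C = 0"
  proof (rule ccontr)
    assume C: "C \<noteq> 0"
    with c0 have d: "degree C \<noteq> degree B" by (metis leading_coeff_0_iff)
    have "lead_coeff (wronskian C B) \<noteq> 0"
      using degree_wronskian(2)[OF C assms(2) d] C assms(2) d by simp
    with w show False by simp
  qed
  then show ?thesis by (simp add: C_def)
qed

section \<open>Solving a Wronskian equation in polynomials\<close>

lemma prod_linear_dvd:
  fixes H :: "complex poly"
  assumes "finite S" "\<And>a. a \<in> S \<Longrightarrow> poly H a = 0"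
  shows "(\<Prod>a\<in>S. [:- a, 1:]) dvd H"
  using assms
proof (induction S arbitrary: H rule: finite_induct)
  case (insert a S)
  from insert.prems[of a] obtain K where K: "H = [:- a, 1:] * K"
    by (auto simp: poly_eq_0_iff_dvd)
  have "poly K b = 0" if "b \<in> S" for b
    using insert.prems[of b] that insert.hyps(2) by (auto simp: K)
  then have "(\<Prod>a\<in>S. [:- a, 1:]) dvd K" by (rule insert.IH)
  then show ?case using insert.hyps by (simp add: K del: mult_pCons_left)
qed simp

lemma rsquarefree_imp_nonzero: "rsquarefree p \<Longrightarrow> p \<noteq> 0"
  by (simp add: rsquarefree_def)

lemma rsquarefree_dvd:
  fixes Q H :: "complex poly"
  assumes "rsquarefree Q" "\<And>z. poly Q z = 0 \<Longrightarrow> poly H z = 0"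
  shows "Q dvd H"
proof -
  have nz: "Q \<noteq> 0" using assms(1) by (rule rsquarefree_imp_nonzero)
  then have "(\<Prod>z|poly Q z = 0. [:-z, 1:]) dvd H"
    using assms(2) poly_roots_finite by (intro prod_linear_dvd) auto
  then have "smult (lead_coeff Q) (\<Prod>z|poly Q z = 0. [:-z, 1:]) dvd H"
    using nz by (simp add: smult_dvd_iff)
  then show ?thesis by (simp add: complex_poly_decompose_rsquarefree[OF assms(1)])
qed

lemma poly_interpolation:
  fixes v :: "complex \<Rightarrow> complex"
  assumes "finite S"
  shows "\<exists>A. \<forall>a\<in>S. poly A a = v a"
  using assms
proof (induction S rule: finite_induct)
  case (insert a S)
  then obtain A where A: "\<forall>b\<in>S. poly A b = v b" by blast
  define L where "L = (\<Prod>b\<in>S. [:- b, 1:])"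
  have L: "poly L b = 0" if "b \<in> S" for b
    using that insert.hyps by (auto simp: L_def poly_prod)
  have La: "poly L a \<noteq> 0"
    using insert.hyps by (auto simp: L_def poly_prod)
  have "\<forall>b\<in>insert a S. poly (A + smult ((v a - poly A a) / poly L a) L) b = v b"
    using A L La by auto
  then show ?case by blast
qed simp

lemma poly_antiderivative:
  fixes H :: "complex poly"
  shows "\<exists>G. pderiv G = H"
proof (induction H)
  case 0
  show ?case by (rule exI[of _ 0]) simp
next
  case (pCons a p)
  have *: "\<exists>G. pderiv G = monom c n" for c :: complex and n
    by (rule exI[of _ "monom (c / of_nat (Suc n)) (Suc n)"]) (simp add: pderiv_monom del: of_nat_Suc)
  have "\<exists>G. pderiv G = (\<Sum>i\<le>N. monom (coeff q i) i)" for q :: "complex poly" and N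
  proof (induction N)
    case (Suc N)
    then show ?case using *[of "coeff q (Suc N)" "Suc N"] by (metis pderiv_add sum.atMost_Suc)
  qed (use * in simp)
  then show ?case by (metis poly_as_sum_of_monoms)
qed

text \<open>The hypothesis at the roots of \<open>B\<close> says that \<open>F / B\<^sup>2\<close> has no residues.\<close>

lemma wronskian_solvable:
  assumes B: "rsquarefree B"
    and res: "\<And>z. poly B z = 0 \<Longrightarrow>
      poly (pderiv F) z * poly (pderiv B) z = poly F z * poly (pderiv (pderiv B)) z"
  shows "\<exists>A. wronskian A B = F"
proof -
  have nz: "B \<noteq> 0" using B by (rule rsquarefree_imp_nonzero)
  have B': "poly (pderiv B) z \<noteq> 0" if "poly B z = 0" for z
    using B that by (auto simp: rsquarefree_roots)
  \<comment> \<open>At a root of \<open>B\<close> the Wronskian of \<open>A0\<close> and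
    \<open>B\<close> is \<open>- A0 * B'\<close>, so these values make it agree with
    \<open>F\<close> there.\<close>
  obtain A0 where A0: "\<forall>z\<in>{z. poly B z = 0}. poly A0 z = - poly F z / poly (pderiv B) z"
    using poly_interpolation[OF poly_roots_finite[OF nz], of "\<lambda>z. - poly F z / poly (pderiv B) z"]
    by blast
  have "B dvd F - wronskian A0 B"
    by (rule rsquarefree_dvd[OF B]) (use A0 B' in \<open>simp add: wronskian_def\<close>)
  then obtain H where H: "F - wronskian A0 B = B * H" by blast
  \<comment> \<open>The remainder is divisible by \<open>B\<close> a second time: at a root of
    \<open>B\<close> its derivative is \<open>B' * H\<close> and also \<open>F' + A0 * B''\<close>,
    which the residue condition makes 0.\<close>
  have "B dvd H"
  proof (rule rsquarefree_dvd[OF B])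
    fix z assume z: "poly B z = 0"
    have "pderiv (F - wronskian A0 B) = pderiv F - pderiv (pderiv A0) * B + A0 * pderiv (pderiv B)"
      unfolding pderiv_diff by (simp add: wronskian_def pderiv_diff pderiv_mult algebra_simps)
    with H have "poly (pderiv F) z + poly A0 z * poly (pderiv (pderiv B)) z
      = poly (pderiv B) z * poly H z"
      using z by (metis (no_types, lifting) add.right_neutral diff_zero mult_zero_left mult_zero_right
          pderiv_mult poly_add poly_diff poly_mult add.commute mult.commute)
    moreover have "poly (pderiv F) z + poly A0 z * poly (pderiv (pderiv B)) z = 0"
      using res[OF z] A0 B'[OF z] z by (simp add: field_simps)
    ultimately show "poly H z = 0" using B'[OF z] by simp
  qed
  then obtain K where K: "H = B * K" by blast
  \<comment> \<open>Adding \<open>B * G\<close> to a solution changes the Wronskian by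
    \<open>B^2 * G'\<close>, so an antiderivative of \<open>K\<close> absorbs the remainder
    \<open>B^2 * K\<close>.\<close>
  obtain G where G: "pderiv G = K" using poly_antiderivative by blast
  have "wronskian (A0 + B * G) B = wronskian A0 B + B * B * K"
    by (simp add: wronskian_def pderiv_add pderiv_mult G algebra_simps)
  also have "\<dots> = F" using H K by (simp add: algebra_simps)
  finally show ?thesis by blast
qed

section \<open>The bracket and the two kinds of step\<close>

lemma no_multiple_or_common_rootsD:
  assumes "no_multiple_or_common_roots P Q"
  shows "rsquarefree P" "rsquarefree Q" "P \<noteq> 0" "Q \<noteq> 0"
    and "poly P z = 0 \<Longrightarrow> poly Q z \<noteq> 0" and "poly Q z = 0 \<Longrightarrow> poly P z \<noteq> 0"
    and "poly P z = 0 \<Longrightarrow> poly (pderiv P) z \<noteq> 0"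
    and "poly Q z = 0 \<Longrightarrow> poly (pderiv Q) z \<noteq> 0"
  using assms rsquarefree_roots
  by (auto simp: no_multiple_or_common_roots_def rsquarefree_imp_nonzero)

lemma poly_bracket2:
  "poly (bracket2 P Q) z = poly (pderiv (pderiv P)) z * poly Q z
    - 4 * poly (pderiv P) z * poly (pderiv Q) z + 4 * poly P z * poly (pderiv (pderiv Q)) z"
  by (simp add: bracket2_def flip: numeral_poly)

text \<open>At a root of \<open>Q\<close> the bracket reduces to
  \<open>4 * (P * Q'' - P' * Q')\<close>, whose vanishing is the residue condition.\<close>

lemma wronskian_solvable_q:
  assumes "no_multiple_or_common_roots P Q" "bracket2 P Q = 0"
  shows "\<exists>A. wronskian A Q = P"
proof (rule wronskian_solvable)
  show "rsquarefree Q" using no_multiple_or_common_rootsD[OF assms(1)] by blast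
  fix z assume "poly Q z = 0"
  then show "poly (pderiv P) z * poly (pderiv Q) z = poly P z * poly (pderiv (pderiv Q)) z"
    using poly_bracket2[of P Q z] assms(2) by simp
qed

text \<open>At a root of \<open>P\<close> the bracket reduces to
  \<open>P'' * Q - 4 * P' * Q'\<close>. Multiplied by \<open>Q^3\<close> it becomes the residue
  condition for \<open>Q^4 / P^2\<close>: the 4 in the bracket is the 4 in
  \<open>(Q^4)' = 4 * Q^3 * Q'\<close>.\<close>

lemma wronskian_solvable_p:
  assumes "no_multiple_or_common_roots P Q" "bracket2 P Q = 0"
  shows "\<exists>A. wronskian A P = Q ^ 4"
proof (rule wronskian_solvable)
  show "rsquarefree P" using no_multiple_or_common_rootsD[OF assms(1)] by blast
  fix z assume "poly P z = 0"
  then have "poly (pderiv (pderiv P)) z * poly Q z = 4 * poly (pderiv P) z * poly (pderiv Q) z"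
    using poly_bracket2[of P Q z] assms(2) by simp
  moreover have "poly (pderiv (Q ^ 4)) z = 4 * poly Q z ^ 3 * poly (pderiv Q) z"
    by (simp add: pderiv_power numeral_poly)
  ultimately show "poly (pderiv (Q ^ 4)) z * poly (pderiv P) z = poly (Q ^ 4) z * poly (pderiv (pderiv P)) z"
    by (simp add: power4_eq_xxxx power3_eq_cube mult_ac)
qed

lemma pderiv_wronskian: "pderiv (wronskian A B) = pderiv (pderiv A) * B - A * pderiv (pderiv B)"
  by (simp add: wronskian_def pderiv_diff pderiv_mult algebra_simps)

text \<open>Abel's identity read backwards. After multiplication by \<open>Q\<close>, the Wronskian
  equation and its derivative eliminate \<open>A' * Q\<close> and \<open>A'' * Q\<close>; the terms
  with \<open>c\<close> cancel and \<open>A * bracket2 P Q\<close> remains.\<close>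

lemma bracket2_wronskian_q:
  assumes "bracket2 P Q = 0" "Q \<noteq> 0" "wronskian A Q = smult c P"
  shows "bracket2 P A = 0"
proof -
  have 1: "pderiv A * Q = smult c P + A * pderiv Q"
    using assms(3) by (simp add: wronskian_def algebra_simps)
  have 2: "pderiv (pderiv A) * Q = smult c (pderiv P) + A * pderiv (pderiv Q)"
    using arg_cong[OF assms(3), of pderiv] by (simp add: pderiv_wronskian pderiv_smult algebra_simps)
  have "Q * bracket2 P A = pderiv (pderiv P) * (Q * A) - 4 * pderiv P * (pderiv A * Q)
      + 4 * P * (pderiv (pderiv A) * Q)"
    by (simp add: bracket2_def algebra_simps)
  also have "\<dots> = A * bracket2 P Q"
    unfolding 1 2 by (simp add: bracket2_def algebra_simps)
  finally show ?thesis using assms(1,2) by simp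
qed

lemma bracket2_wronskian_p:
  assumes "bracket2 P Q = 0" "P \<noteq> 0" "wronskian A P = smult c (Q ^ 4)"
  shows "bracket2 A Q = 0"
proof -
  have 1: "pderiv A * P = smult c (Q ^ 4) + A * pderiv P"
    using assms(3) by (simp add: wronskian_def algebra_simps)
  have 2: "pderiv (pderiv A) * P = smult c (4 * Q ^ 3 * pderiv Q) + A * pderiv (pderiv P)"
    using arg_cong[OF assms(3), of pderiv]
    by (simp add: pderiv_wronskian pderiv_smult pderiv_power algebra_simps numeral_poly)
  have "P * bracket2 A Q = (pderiv (pderiv A) * P) * Q - 4 * (pderiv A * P) * pderiv Q
      + 4 * P * A * pderiv (pderiv Q)"
    by (simp add: bracket2_def algebra_simps)
  also have "\<dots> = A * bracket2 P Q"
    unfolding 1 2 by (simp add: bracket2_def algebra_simps power4_eq_xxxx power3_eq_cube)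
  finally show ?thesis using assms(1,2) by simp
qed

text \<open>A multiple root of \<open>A + t B\<close> is a root of its Wronskian with
  \<open>B\<close>, which is \<open>F\<close> for every \<open>t\<close>. So avoiding the roots of
  \<open>F\<close> gives simple roots as well, and each root of \<open>F\<close> forbids just one
  \<open>t\<close> because \<open>B\<close> does not vanish there.\<close>

lemma generic_solution_rsquarefree:
  assumes W: "wronskian A B = F" and F: "F \<noteq> 0" and nc: "\<And>z. poly F z = 0 \<Longrightarrow> poly B z \<noteq> 0"
  shows "\<exists>S. finite S \<and> (\<forall>t. t \<notin> S \<longrightarrow> rsquarefree (A + smult t B) \<and>
      (\<forall>z. poly F z = 0 \<longrightarrow> poly (A + smult t B) z \<noteq> 0))"
proof (intro exI conjI allI impI)
  let ?S = "(\<lambda>z. - poly A z / poly B z) ` {z. poly F z = 0}"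
  show "finite ?S" using poly_roots_finite[OF F] by simp
  fix t assume t: "t \<notin> ?S"
  show *: "poly (A + smult t B) z \<noteq> 0" if "poly F z = 0" for z
  proof
    assume "poly (A + smult t B) z = 0"
    then have "t = - poly A z / poly B z"
      using nc[OF that] by (simp add: field_simps eq_neg_iff_add_eq_0)
    with t that show False by auto
  qed
  show "rsquarefree (A + smult t B)"
    unfolding rsquarefree_roots
  proof (intro allI notI)
    fix z assume z: "poly (A + smult t B) z = 0 \<and> poly (pderiv (A + smult t B)) z = 0"
    have "wronskian (A + smult t B) B = F" by (simp add: wronskian_add_left wronskian_smult_left W)
    then have "poly F z = poly (wronskian (A + smult t B) B) z" by simp
    also have "\<dots> = 0" unfolding wronskian_def poly_diff poly_mult using z by simp
    finally show False using * z by blast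
  qed
qed

section \<open>Limits of pairs with simple and distinct roots\<close>

text \<open>Convergence in the finite-dimensional space of polynomials of degree at most
  \<open>D\<close>. The degree may drop in the limit, so leading coefficients are not
  controlled.\<close>

definition poly_tendsto :: "nat \<Rightarrow> (nat \<Rightarrow> complex poly) \<Rightarrow> complex poly \<Rightarrow> bool" where
  "poly_tendsto D X P \<longleftrightarrow>
     (\<forall>n. degree (X n) \<le> D) \<and> (\<forall>j. (\<lambda>n. coeff (X n) j) \<longlonglongrightarrow> coeff P j)"

lemma poly_tendstoD:
  assumes "poly_tendsto D X P"
  shows "degree (X n) \<le> D" "(\<lambda>n. coeff (X n) j) \<longlonglongrightarrow> coeff P j"
  using assms by (auto simp: poly_tendsto_def)

lemma poly_tendsto_const: "degree P \<le> D \<Longrightarrow> poly_tendsto D (\<lambda>_. P) P"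
  by (simp add: poly_tendsto_def)

lemma poly_tendsto_mono: "poly_tendsto D X P \<Longrightarrow> D \<le> E \<Longrightarrow> poly_tendsto E X P"
  by (auto simp: poly_tendsto_def intro: order_trans)

lemma poly_tendsto_unique: "poly_tendsto D X P \<Longrightarrow> poly_tendsto E X Q \<Longrightarrow> P = Q"
  unfolding poly_tendsto_def poly_eq_iff by (meson LIMSEQ_unique)

lemma poly_tendsto_subseq:
  assumes "poly_tendsto D X P" "strict_mono r"
  shows "poly_tendsto D (\<lambda>n. X (r n)) P"
  using assms LIMSEQ_subseq_LIMSEQ[OF _ assms(2)] by (auto simp: poly_tendsto_def o_def)

lemma poly_tendsto_add:
  assumes "poly_tendsto D X P" "poly_tendsto D Y Q"
  shows "poly_tendsto D (\<lambda>n. X n + Y n) (P + Q)"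
  using assms by (auto simp: poly_tendsto_def intro!: tendsto_intros degree_add_le)

lemma poly_tendsto_diff:
  assumes "poly_tendsto D X P" "poly_tendsto D Y Q"
  shows "poly_tendsto D (\<lambda>n. X n - Y n) (P - Q)"
  using assms by (auto simp: poly_tendsto_def intro!: tendsto_intros degree_diff_le)

lemma poly_tendsto_smult:
  assumes "poly_tendsto D X P" "c \<longlonglongrightarrow> c'"
  shows "poly_tendsto D (\<lambda>n. smult (c n) (X n)) (smult c' P)"
  using assms
  by (auto simp: poly_tendsto_def intro!: tendsto_intros intro: order_trans[OF degree_smult_le])

lemma poly_tendsto_mult:
  assumes "poly_tendsto D X P" "poly_tendsto E Y Q"
  shows "poly_tendsto (D + E) (\<lambda>n. X n * Y n) (P * Q)"
  unfolding poly_tendsto_def coeff_mult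
proof (intro conjI allI)
  show "degree (X n * Y n) \<le> D + E" for n
    using degree_mult_le[of "X n" "Y n"] poly_tendstoD(1)[OF assms(1), of n]
      poly_tendstoD(1)[OF assms(2), of n] by linarith
qed (intro tendsto_intros poly_tendstoD[OF assms(1)] poly_tendstoD[OF assms(2)])

lemma poly_tendsto_pderiv:
  assumes "poly_tendsto D X P"
  shows "poly_tendsto D (\<lambda>n. pderiv (X n)) (pderiv P)"
  unfolding poly_tendsto_def
proof (intro conjI allI)
  show "degree (pderiv (X n)) \<le> D" for n
    using poly_tendstoD(1)[OF assms, of n] by (simp add: degree_pderiv)
  show "(\<lambda>n. coeff (pderiv (X n)) j) \<longlonglongrightarrow> coeff (pderiv P) j" for j
    unfolding coeff_pderiv by (intro tendsto_intros poly_tendstoD[OF assms])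
qed

lemma poly_tendsto_power4:
  assumes "poly_tendsto D X P"
  shows "poly_tendsto (4 * D) (\<lambda>n. X n ^ 4) (P ^ 4)"
proof -
  have "poly_tendsto (D + D + (D + D)) (\<lambda>n. X n ^ 4) (P ^ 4)"
    using poly_tendsto_mult[OF poly_tendsto_mult[OF assms assms] poly_tendsto_mult[OF assms assms]]
    by (simp add: power4_eq_xxxx mult.assoc)
  then show ?thesis by (rule poly_tendsto_mono) simp
qed

lemma poly_tendsto_wronskian:
  assumes "poly_tendsto D X P" "poly_tendsto E Y Q"
  shows "poly_tendsto (D + E) (\<lambda>n. wronskian (X n) (Y n)) (wronskian P Q)"
  unfolding wronskian_def by (intro poly_tendsto_diff poly_tendsto_mult poly_tendsto_pderiv assms)

lemma poly_tendsto_bracket2: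
  assumes "poly_tendsto D X P" "poly_tendsto E Y Q"
  shows "poly_tendsto (D + E) (\<lambda>n. bracket2 (X n) (Y n)) (bracket2 P Q)"
proof -
  have eq: "bracket2 p q = pderiv (pderiv p) * q - smult 4 (pderiv p * pderiv q)
      + smult 4 (p * pderiv (pderiv q))" for p q
    by (simp add: bracket2_def numeral_poly)
  show ?thesis unfolding eq
    by (intro poly_tendsto_add poly_tendsto_diff poly_tendsto_mult poly_tendsto_smult poly_tendsto_pderiv
        assms tendsto_const)
qed

text \<open>Bolzano-Weierstrass for the coefficients; the degree bound makes the limit finitely
  supported, hence a polynomial.\<close>

lemma poly_bounded_subseq:
  fixes X :: "nat \<Rightarrow> complex poly"
  assumes deg: "\<And>n. degree (X n) \<le> D" and bdd: "\<And>n j. cmod (coeff (X n) j) \<le> M"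
  shows "\<exists>r C. strict_mono r \<and> poly_tendsto D (\<lambda>n. X (r n)) C"
proof -
  obtain r :: "nat \<Rightarrow> nat" where r: "strict_mono r"
    and "\<And>j. j \<in> (UNIV :: nat set) \<Longrightarrow> \<exists>l. (\<lambda>n. coeff (X (r n)) j) \<longlonglongrightarrow> l"
    by (rule function_convergent_subsequence[of "UNIV :: nat set" "\<lambda>n. coeff (X n)" M])
       (use bdd in auto)
  then obtain l where l: "\<And>j. (\<lambda>n. coeff (X (r n)) j) \<longlonglongrightarrow> l j" by (metis UNIV_I)
  have l0: "l j = 0" if "D < j" for j
  proof -
    have "coeff (X (r n)) j = 0" for n
      using deg[of "r n"] that by (intro coeff_eq_0) auto
    then show ?thesis using l[of j] by (simp add: LIMSEQ_const_iff)
  qed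
  have "coeff (Abs_poly l) = l"
    by (rule coeff_Abs_poly[of D]) (use l0 in auto)
  then have "poly_tendsto D (\<lambda>n. X (r n)) (Abs_poly l)"
    using l deg by (simp add: poly_tendsto_def)
  with r show ?thesis by blast
qed

lemma degree_wronskian_solution:
  assumes "wronskian A B = F" "B \<noteq> 0"
  shows "degree A \<le> max (degree B) (Suc (degree F))"
proof (cases "A = 0 \<or> degree A = degree B")
  case False
  then show ?thesis using degree_wronskian(1)[of A B] assms by auto
qed auto

lemma wronskian_solution_normalize:
  assumes "wronskian A B = F" "coeff B d \<noteq> 0"
  shows "\<exists>A. wronskian A B = F \<and> coeff A d = 0"
  by (rule exI[of _ "A - smult (coeff A d / coeff B d) B"])
     (use assms in \<open>simp add: wronskian_diff_left wronskian_smult_left\<close>)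

text \<open>
  The kernel of \<open>\<lambda>A. wronskian A B\<close> is spanned by \<open>B\<close>, so its dimension does not jump in the limit and
  solvability is a closed condition. Requiring the coefficient of \<open>A\<close> at the degree of the limit
  \<open>B0\<close> to vanish makes the solutions bounded.
\<close>

lemma wronskian_solution_limit:
  assumes B: "poly_tendsto D B B0" and F: "poly_tendsto D F F0" and B0: "B0 \<noteq> 0"
    and nz: "\<And>n. B n \<noteq> 0" and sol: "\<And>n. \<exists>A. wronskian A (B n) = F n"
  shows "\<exists>r A A0. strict_mono r \<and> poly_tendsto (Suc D) A A0 \<and> (\<forall>n. wronskian (A n) (B (r n)) = F (r n))"
proof -
  define d where "d = degree B0"
  have "coeff B0 d \<noteq> 0" using B0 by (simp add: d_def)
  then have "eventually (\<lambda>n. coeff (B n) d \<noteq> 0) sequentially"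
    by (rule tendsto_imp_eventually_ne[OF poly_tendstoD(2)[OF B]])
  then obtain N where N: "\<And>n. N \<le> n \<Longrightarrow> coeff (B n) d \<noteq> 0"
    by (auto simp: eventually_sequentially)
  define s where "s = (\<lambda>n. n + N)"
  have s: "strict_mono s" by (simp add: s_def strict_mono_def)
  have "\<exists>A. wronskian A (B (s n)) = F (s n) \<and> coeff A d = 0" for n
    using sol[of "s n"] N[of "s n"] wronskian_solution_normalize by (metis le_add2 s_def)
  then obtain A where A: "\<And>n. wronskian (A n) (B (s n)) = F (s n)" and A0: "\<And>n. coeff (A n) d = 0"
    by metis
  have degA: "degree (A n) \<le> Suc D" for n
    using degree_wronskian_solution[OF A nz, of n] poly_tendstoD(1)[OF B, of "s n"]
      poly_tendstoD(1)[OF F, of "s n"] by simp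
  \<comment> \<open>Boundedness of the \<open>A n\<close> is not known yet, so they are rescaled by
    their size. The summand 1 keeps \<open>1 / M n\<close> within \<open>{0..1}\<close>, so that it
    has a convergent subsequence; its limit \<open>\<mu>\<close> is nonzero exactly if the sizes
    stay bounded along it.\<close>
  define M where "M n = 1 + (\<Sum>j\<le>Suc D. cmod (coeff (A n) j))" for n
  have M: "1 \<le> M n" for n by (simp add: M_def sum_nonneg)
  then have M0: "M n \<noteq> 0" for n by (metis not_one_le_zero)
  define X where "X n = smult (of_real (1 / M n)) (A n)" for n
  have degX: "degree (X n) \<le> Suc D" for n
    using degA[of n] degree_smult_le[of _ "A n"] by (simp add: X_def)
  have "cmod (coeff (A n) j) \<le> M n" for n j
  proof (cases "j \<le> Suc D")
    case True
    then have "cmod (coeff (A n) j) \<le> (\<Sum>j\<le>Suc D. cmod (coeff (A n) j))"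
      by (intro member_le_sum) auto
    then show ?thesis by (simp add: M_def)
  next
    case False
    then have "coeff (A n) j = 0" using degA[of n] by (intro coeff_eq_0) auto
    then show ?thesis using M[of n] by simp
  qed
  then have bddX: "cmod (coeff (X n) j) \<le> 1" for n j
    using M[of n] by (simp add: X_def norm_mult norm_divide divide_simps)
  have "1 / M n \<in> {0..1}" for n using M[of n] by simp
  then obtain \<mu> r1 where r1: "strict_mono (r1 :: nat \<Rightarrow> nat)"
    and "((\<lambda>n. 1 / M n) \<circ> r1) \<longlonglongrightarrow> \<mu>"
    using seq_compactE[OF compact_imp_seq_compact[OF compact_Icc]] by metis
  then have \<mu>1: "(\<lambda>n. 1 / M (r1 n)) \<longlonglongrightarrow> \<mu>" by (simp add: o_def)
  obtain r2 C where r2: "strict_mono (r2 :: nat \<Rightarrow> nat)"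
    and C: "poly_tendsto (Suc D) (\<lambda>n. X (r1 (r2 n))) C"
    using poly_bounded_subseq[of "\<lambda>n. X (r1 n)" "Suc D" 1] degX bddX by blast
  define r where "r = (\<lambda>n. r1 (r2 n))"
  have r: "strict_mono r" using r1 r2 by (simp add: r_def strict_mono_def)
  have \<mu>: "(\<lambda>n. 1 / M (r n)) \<longlonglongrightarrow> \<mu>"
    using LIMSEQ_subseq_LIMSEQ[OF \<mu>1 r2] by (simp add: o_def r_def)
  have sr: "strict_mono (\<lambda>n. s (r n))" using s r by (simp add: strict_mono_def)
  have "poly_tendsto (Suc D + D) (\<lambda>n. wronskian (X (r n)) (B (s (r n)))) (wronskian C B0)"
    using C by (intro poly_tendsto_wronskian poly_tendsto_subseq[OF B sr]) (simp add: r_def)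
  moreover have "wronskian (X n) (B (s n)) = smult (of_real (1 / M n)) (F (s n))" for n
    by (simp add: X_def wronskian_smult_left A)
  moreover have "poly_tendsto D (\<lambda>n. smult (of_real (1 / M (r n))) (F (s (r n)))) (smult (of_real \<mu>) F0)"
    by (intro poly_tendsto_smult poly_tendsto_subseq[OF F sr] tendsto_of_real \<mu>)
  ultimately have WC: "wronskian C B0 = smult (of_real \<mu>) F0"
    using poly_tendsto_unique by auto
  have C0: "coeff C d = 0"
    using poly_tendstoD(2)[OF C, of d] A0 by (simp add: X_def LIMSEQ_const_iff)
  \<comment> \<open>If \<open>\<mu> = 0\<close>, the limit \<open>C\<close> lies in the kernel, and
    its vanishing coefficient at \<open>d\<close> forces \<open>C = 0\<close>. But the absolute
    values of the coefficients of \<open>X n\<close> sum to \<open>1 - 1 / M n\<close>, which would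
    tend to 1.\<close>
  have "\<mu> \<noteq> 0"
  proof
    assume "\<mu> = 0"
    with WC have "C = 0"
      using wronskian_eq_0_imp[of C B0] B0 C0 by (simp add: d_def)
    then have "(\<lambda>n. \<Sum>j\<le>Suc D. cmod (coeff (X (r n)) j)) \<longlonglongrightarrow> (\<Sum>j\<le>Suc D. cmod 0)"
      using poly_tendstoD(2)[OF C] by (intro tendsto_sum tendsto_norm) (simp add: r_def)
    moreover have "(\<Sum>j\<le>Suc D. cmod (coeff (X n) j)) = 1 - 1 / M n" for n
    proof -
      have "(\<Sum>j\<le>Suc D. cmod (coeff (X n) j)) = (\<Sum>j\<le>Suc D. cmod (coeff (A n) j)) / M n"
        unfolding sum_divide_distrib using M[of n] by (simp add: X_def norm_mult norm_divide)
      also have "\<dots> = (M n - 1) / M n" by (simp add: M_def)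
      finally show ?thesis using M0[of n] by (simp add: diff_divide_distrib)
    qed
    moreover have "(\<lambda>n. 1 - 1 / M (r n)) \<longlonglongrightarrow> 1 - 0"
      using \<mu> \<open>\<mu> = 0\<close> by (intro tendsto_intros) simp
    ultimately show False using LIMSEQ_unique by fastforce
  qed
  then have "(\<lambda>n. complex_of_real (inverse (1 / M (r n)))) \<longlonglongrightarrow> of_real (inverse \<mu>)"
    by (intro tendsto_of_real tendsto_inverse \<mu>)
  then have "poly_tendsto (Suc D) (\<lambda>n. smult (of_real (inverse (1 / M (r n)))) (X (r n)))
      (smult (of_real (inverse \<mu>)) C)"
    using C by (intro poly_tendsto_smult) (simp_all add: r_def)
  moreover have "smult (of_real (inverse (1 / M n))) (X n) = A n" for n
    using M0[of n] by (simp add: X_def)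
  ultimately have "poly_tendsto (Suc D) (\<lambda>n. A (r n)) (smult (of_real (inverse \<mu>)) C)"
    by simp
  then show ?thesis using sr A by blast
qed

text \<open>Beyond solvability of the limit equation, each of its solutions with
  \<open>c \<noteq> 0\<close> is reached by approximants with simple roots. A prescribed
  \<open>A0\<close> differs from \<open>c\<close> times the limit solution by some
  \<open>k * B0\<close>; adding \<open>k * B n\<close> to the approximants corrects this, and a
  further \<open>t n * B n\<close> with \<open>t n\<close> tending to 0 makes them generic.\<close>

lemma wronskian_solution_approx:
  assumes B: "poly_tendsto D B B0" and F: "poly_tendsto D F F0" and B0: "B0 \<noteq> 0"
    and nz: "\<And>n. B n \<noteq> 0" "\<And>n. F n \<noteq> 0" and sol: "\<And>n. \<exists>A. wronskian A (B n) = F n"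
    and nc: "\<And>n. \<forall>z. poly (F n) z = 0 \<longrightarrow> poly (B n) z \<noteq> 0"
  shows "\<exists>A. wronskian A B0 = F0"
    and "wronskian A0 B0 = smult c F0 \<Longrightarrow> c \<noteq> 0 \<Longrightarrow>
      \<exists>r A. strict_mono r \<and> poly_tendsto (Suc D) A A0 \<and>
        (\<forall>n. wronskian (A n) (B (r n)) = smult c (F (r n)) \<and> rsquarefree (A n) \<and>
          (\<forall>z. poly (F (r n)) z = 0 \<longrightarrow> poly (A n) z \<noteq> 0))"
proof -
  obtain r A A1 where r: "strict_mono r" and A: "poly_tendsto (Suc D) A A1"
    and W: "\<And>n. wronskian (A n) (B (r n)) = F (r n)"
    using wronskian_solution_limit[OF B F B0 nz(1) sol] by blast
  note Br = poly_tendsto_subseq[OF B r] and Fr = poly_tendsto_subseq[OF F r]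
  have W1: "wronskian A1 B0 = F0"
    using poly_tendsto_wronskian[OF A Br] Fr poly_tendsto_unique unfolding W by blast
  then show "\<exists>A. wronskian A B0 = F0" by blast
  assume W0: "wronskian A0 B0 = smult c F0" and c: "c \<noteq> 0"
  have "wronskian (A0 - smult c A1) B0 = 0"
    by (simp add: wronskian_diff_left wronskian_smult_left W0 W1)
  then obtain k where "A0 - smult c A1 = smult k B0"
    using wronskian_eq_0_imp[OF _ B0] by blast
  then have A0: "A0 = smult c A1 + smult k B0" by (simp add: algebra_simps)
  define X where "X n = smult c (A n) + smult k (B (r n))" for n
  have WX: "wronskian (X n) (B (r n)) = smult c (F (r n))" for n
    by (simp add: X_def wronskian_add_left wronskian_smult_left W)
  have "\<exists>t. cmod t < 1 / real (Suc n) \<and> rsquarefree (X n + smult t (B (r n))) \<and>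
      (\<forall>z. poly (F (r n)) z = 0 \<longrightarrow> poly (X n + smult t (B (r n))) z \<noteq> 0)" for n
  proof -
    obtain S where S: "finite S" and *: "\<forall>t. t \<notin> S \<longrightarrow> rsquarefree (X n + smult t (B (r n))) \<and>
        (\<forall>z. poly (smult c (F (r n))) z = 0 \<longrightarrow> poly (X n + smult t (B (r n))) z \<noteq> 0)"
      using generic_solution_rsquarefree[OF WX, of n] c nz(2) nc by auto
    \<comment> \<open>Only finitely many values of \<open>t\<close> are bad, so every ball around 0
      contains a good one.\<close>
    have "uncountable (ball (0 :: complex) (1 / real (Suc n)))"
      by (intro uncountable_ball) simp
    then have "\<not> ball 0 (1 / real (Suc n)) \<subseteq> S"
      using S countable_finite countable_subset by blast
    then obtain t where "t \<in> ball 0 (1 / real (Suc n))" "t \<notin> S" by blast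
    then show ?thesis using * by auto
  qed
  then obtain t where t: "\<And>n. cmod (t n) < 1 / real (Suc n)"
    and *: "\<And>n. rsquarefree (X n + smult (t n) (B (r n)))"
      "\<And>n z. poly (F (r n)) z = 0 \<Longrightarrow> poly (X n + smult (t n) (B (r n))) z \<noteq> 0"
    by metis
  have "t \<longlonglongrightarrow> 0"
    by (rule LIMSEQ_norm_0[OF t])
  then have "poly_tendsto (Suc D) (\<lambda>n. X n + smult (t n) (B (r n))) (A0 + smult 0 B0)"
    unfolding A0 X_def using poly_tendsto_mono[OF Br, of "Suc D"]
    by (intro poly_tendsto_add poly_tendsto_smult A tendsto_const) auto
  moreover have "wronskian (X n + smult (t n) (B (r n))) (B (r n)) = smult c (F (r n))" for n
    by (simp add: wronskian_add_left wronskian_smult_left WX)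
  ultimately show "\<exists>r A. strict_mono r \<and> poly_tendsto (Suc D) A A0 \<and>
        (\<forall>n. wronskian (A n) (B (r n)) = smult c (F (r n)) \<and> rsquarefree (A n) \<and>
          (\<forall>z. poly (F (r n)) z = 0 \<longrightarrow> poly (A n) z \<noteq> 0))"
    using r * by (intro exI[of _ r] exI[of _ "\<lambda>n. X n + smult (t n) (B (r n))"]) auto
qed

text \<open>Nonvanishing is required of the limits themselves, because all coefficients of nonzero
  approximants may tend to 0.\<close>

definition limit_of_simple :: "complex poly \<Rightarrow> complex poly \<Rightarrow> bool" where
  "limit_of_simple P Q \<longleftrightarrow> P \<noteq> 0 \<and> Q \<noteq> 0 \<and>
     (\<exists>D Ps Qs. poly_tendsto D Ps P \<and> poly_tendsto D Qs Q \<and>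
        (\<forall>n. no_multiple_or_common_roots (Ps n) (Qs n) \<and> bracket2 (Ps n) (Qs n) = 0))"

lemma limit_of_simpleI:
  assumes "no_multiple_or_common_roots P Q" "bracket2 P Q = 0"
  shows "limit_of_simple P Q"
  unfolding limit_of_simple_def
proof (intro conjI exI)
  let ?D = "max (degree P) (degree Q)"
  show "poly_tendsto ?D (\<lambda>_. P) P" "poly_tendsto ?D (\<lambda>_. Q) Q" by (auto intro: poly_tendsto_const)
qed (use assms no_multiple_or_common_rootsD in auto)

lemma limit_of_simple_nonzero: "limit_of_simple P Q \<Longrightarrow> P \<noteq> 0" "limit_of_simple P Q \<Longrightarrow> Q \<noteq> 0"
  by (auto simp: limit_of_simple_def)

lemma limit_of_simple_bracket2:
  assumes "limit_of_simple P Q"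
  shows "bracket2 P Q = 0"
proof -
  obtain D Ps Qs where "poly_tendsto D Ps P" "poly_tendsto D Qs Q" "\<And>n. bracket2 (Ps n) (Qs n) = 0"
    using assms by (auto simp: limit_of_simple_def)
  then have "poly_tendsto (D + D) (\<lambda>n. 0) (bracket2 P Q)"
    using poly_tendsto_bracket2 by fastforce
  then show ?thesis using poly_tendsto_unique poly_tendsto_const by (metis degree_0 le0)
qed

text \<open>The second part admits every solution \<open>A\<close>, whatever its integration
  constant, so the property survives steps that create multiple or common roots.\<close>

lemma limit_of_simple_step_q:
  assumes "limit_of_simple P Q"
  shows "\<exists>A. wronskian A Q = P" and "wronskian A Q = smult c P \<Longrightarrow> c \<noteq> 0 \<Longrightarrow> limit_of_simple P A"
proof -
  obtain D Ps Qs where P: "poly_tendsto D Ps P" and Q: "poly_tendsto D Qs Q"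
    and simple: "\<And>n. no_multiple_or_common_roots (Ps n) (Qs n)"
    and br: "\<And>n. bracket2 (Ps n) (Qs n) = 0"
    using assms by (auto simp: limit_of_simple_def)
  note nD = no_multiple_or_common_rootsD[OF simple]
  have nc: "\<forall>z. poly (Ps n) z = 0 \<longrightarrow> poly (Qs n) z \<noteq> 0" for n using nD(5) by blast
  note * = wronskian_solution_approx[OF Q P limit_of_simple_nonzero(2)[OF assms] nD(4,3) wronskian_solvable_q[OF simple br] nc]
  show "\<exists>A. wronskian A Q = P" by (rule *(1))
  assume W: "wronskian A Q = smult c P" and c: "c \<noteq> 0"
  obtain r As where r: "strict_mono r" and A: "poly_tendsto (Suc D) As A"
    and As: "\<And>n. wronskian (As n) (Qs (r n)) = smult c (Ps (r n))" "\<And>n. rsquarefree (As n)"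
      "\<And>n z. poly (Ps (r n)) z = 0 \<Longrightarrow> poly (As n) z \<noteq> 0"
    using *(2)[OF W c] by blast
  show "limit_of_simple P A" unfolding limit_of_simple_def
  proof (intro conjI exI allI)
    show "P \<noteq> 0" using assms by (rule limit_of_simple_nonzero)
    then show "A \<noteq> 0" using W c by auto
    show "poly_tendsto (Suc D) (\<lambda>n. Ps (r n)) P"
      using poly_tendsto_mono[OF poly_tendsto_subseq[OF P r]] by simp
    show "no_multiple_or_common_roots (Ps (r n)) (As n)" for n
      using As(2,3) nD(1) by (auto simp: no_multiple_or_common_roots_def)
    show "bracket2 (Ps (r n)) (As n) = 0" for n
      using bracket2_wronskian_q[OF br nD(4) As(1)] .
  qed (rule A)
qed

lemma limit_of_simple_step_p:
  assumes "limit_of_simple P Q"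
  shows "\<exists>A. wronskian A P = Q ^ 4" and "wronskian A P = smult c (Q ^ 4) \<Longrightarrow> c \<noteq> 0 \<Longrightarrow> limit_of_simple A Q"
proof -
  obtain D Ps Qs where P: "poly_tendsto D Ps P" and Q: "poly_tendsto D Qs Q"
    and simple: "\<And>n. no_multiple_or_common_roots (Ps n) (Qs n)"
    and br: "\<And>n. bracket2 (Ps n) (Qs n) = 0"
    using assms by (auto simp: limit_of_simple_def)
  note nD = no_multiple_or_common_rootsD[OF simple]
  \<comment> \<open>A single bound has to serve both sequences, and the fourth power raises that of
    \<open>Qs\<close> to \<open>4 * D\<close>.\<close>
  have P4: "poly_tendsto (4 * D) Ps P" using poly_tendsto_mono[OF P] by simp
  have nz4: "Qs n ^ 4 \<noteq> 0" for n using nD(4) by simp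
  have nc4: "\<forall>z. poly (Qs n ^ 4) z = 0 \<longrightarrow> poly (Ps n) z \<noteq> 0" for n using nD(6) by simp
  note * = wronskian_solution_approx[OF P4 poly_tendsto_power4[OF Q] limit_of_simple_nonzero(1)[OF assms] nD(3) nz4
      wronskian_solvable_p[OF simple br] nc4]
  show "\<exists>A. wronskian A P = Q ^ 4" by (rule *(1))
  assume W: "wronskian A P = smult c (Q ^ 4)" and c: "c \<noteq> 0"
  obtain r As where r: "strict_mono r" and A: "poly_tendsto (Suc (4 * D)) As A"
    and As: "\<And>n. wronskian (As n) (Ps (r n)) = smult c (Qs (r n) ^ 4)" "\<And>n. rsquarefree (As n)"
      "\<And>n z. poly (Qs (r n) ^ 4) z = 0 \<Longrightarrow> poly (As n) z \<noteq> 0"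
    using *(2)[OF W c] by blast
  show "limit_of_simple A Q" unfolding limit_of_simple_def
  proof (intro conjI exI allI)
    show "Q \<noteq> 0" using assms by (rule limit_of_simple_nonzero)
    then show "A \<noteq> 0" using W c by auto
    show "poly_tendsto (Suc (4 * D)) (\<lambda>n. Qs (r n)) Q"
      using poly_tendsto_mono[OF poly_tendsto_subseq[OF Q r]] by simp
    show "no_multiple_or_common_roots (As n) (Qs (r n))" for n
      using As(2,3) nD(2) by (auto simp: no_multiple_or_common_roots_def)
    show "bracket2 (As n) (Qs (r n)) = 0" for n
      using bracket2_wronskian_p[OF br nD(3) As(1)] .
  qed (rule A)
qed

section \<open>Chains of polynomial solutions\<close>

text \<open>
  \<open>pq_state i\<close> describes the pairs that can occur as \<open>(p\<^sub>i, q\<^sub>i)\<close>, and \<open>pq_next_state i\<close> those that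
  can occur as \<open>(p\<^sub>i, q\<^sub>i\<^sub>+\<^sub>1)\<close>.
\<close>

definition pq_state :: "int \<Rightarrow> complex poly \<Rightarrow> complex poly \<Rightarrow> bool" where
  "pq_state i P Q \<longleftrightarrow> limit_of_simple P Q \<and> lead_coeff P = 1 \<and> lead_coeff Q = 1 \<and>
     int (degree P) = i * (3 * i + 2) \<and> 2 * int (degree Q) = i * (3 * i - 1)"

definition pq_next_state :: "int \<Rightarrow> complex poly \<Rightarrow> complex poly \<Rightarrow> bool" where
  "pq_next_state i P Q \<longleftrightarrow> limit_of_simple P Q \<and> lead_coeff P = 1 \<and> lead_coeff Q = 1 \<and>
     int (degree P) = i * (3 * i + 2) \<and> 2 * int (degree Q) = (i + 1) * (3 * i + 2)"

text \<open>The leading coefficient of a Wronskian contains the degree difference as a factor, so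
  scaling by that difference makes the solution monic. Removing the coefficient at
  \<open>degree B\<close> beforehand ensures that the degrees differ.\<close>

lemma wronskian_monic_solution:
  assumes "wronskian A0 B = F" "lead_coeff B = 1" "lead_coeff F = 1"
  shows "\<exists>A. lead_coeff A = 1 \<and> int (degree A) + int (degree B) = int (degree F) + 1 \<and>
    degree A \<noteq> degree B \<and> wronskian A B = smult (of_int (int (degree A) - int (degree B))) F"
proof -
  have B: "coeff B (degree B) \<noteq> 0" "B \<noteq> 0" using assms(2) by auto
  obtain A1 where A1: "wronskian A1 B = F" "coeff A1 (degree B) = 0"
    using wronskian_solution_normalize[OF assms(1) B(1)] by blast
  have nz: "A1 \<noteq> 0" using A1(1) assms(3) by auto
  with A1(2) have d: "degree A1 \<noteq> degree B" by (metis leading_coeff_0_iff)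
  have 1: "Suc (degree F) = degree A1 + degree B"
    and 2: "(of_nat (degree A1) - of_nat (degree B)) * lead_coeff A1 = 1"
    using degree_wronskian[OF nz B(2) d] assms A1 by auto
  define A where "A = smult (of_int (int (degree A1) - int (degree B))) A1"
  have deg: "degree A = degree A1" using d by (simp add: A_def)
  have "of_nat (degree A1) - of_nat (degree B) \<noteq> (0 :: complex)" using d by simp
  then have "lead_coeff A = 1" using 2 d by (simp add: A_def)
  moreover have "wronskian A B = smult (of_int (int (degree A) - int (degree B))) F"
    by (simp add: A_def wronskian_smult_left A1(1) d)
  ultimately show ?thesis using 1 d deg by (intro exI[of _ A]) auto
qed

text \<open>The last hypothesis excludes equal degrees, for which the Wronskian would have too small
  a degree. Thus the conclusion holds for all integration constants, and \<open>A\<close> has the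
  larger degree.\<close>

lemma wronskian_solution_degree:
  assumes "wronskian A B = smult c F" "c \<noteq> 0" "lead_coeff B = 1" "lead_coeff F = 1"
    and "2 * int (degree B) < int (degree F) + 2"
  shows "int (degree A) + int (degree B) = int (degree F) + 1"
    and "of_int (int (degree A) - int (degree B)) * lead_coeff A = c"
proof -
  have B: "B \<noteq> 0" and F: "F \<noteq> 0" using assms by auto
  have A: "A \<noteq> 0" using assms(1,2) F by auto
  have d: "degree A \<noteq> degree B"
  proof
    assume eq: "degree A = degree B"
    show False
    proof (cases "degree B = 0")
      case True
      with eq have "pderiv A = 0" "pderiv B = 0" by (simp_all add: pderiv_eq_0_iff)
      then show False using assms(1,2) F by (simp add: wronskian_def)
    next
      case False
      then show False using degree_wronskian_same[OF eq] assms by simp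
    qed
  qed
  show "int (degree A) + int (degree B) = int (degree F) + 1"
    using degree_wronskian(1)[OF A B d] assms(1,2) by simp
  show "of_int (int (degree A) - int (degree B)) * lead_coeff A = c"
    using degree_wronskian(2)[OF A B d] assms by simp
qed

lemma wronskian_commute_smult:
  "wronskian A B = smult (of_int k) F \<Longrightarrow> wronskian B A = smult (of_int (- k)) F"
  using wronskian_commute[of B A] by simp

lemma linear_coeff_nonzero: "3 * i + 1 \<noteq> (0 :: int)" "6 * i - 1 \<noteq> (0 :: int)"
  by presburger+

lemma lead_coeff_eq_one:
  assumes "of_int k * x = (of_int k :: complex)" "k \<noteq> 0"
  shows "x = 1"
  using assms by simp

lemma pq_state_next:
  assumes "pq_state i P Q" "wronskian A Q = smult (of_int (3 * i + 1)) P"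
    and "lead_coeff A = 1" "int (degree A) + int (degree Q) = int (degree P) + 1"
  shows "pq_next_state i P A"
proof -
  have "limit_of_simple P A"
    using limit_of_simple_step_q(2)[OF _ assms(2)] assms(1) linear_coeff_nonzero(1)[of i]
    by (metis of_int_eq_0_iff pq_state_def)
  then show ?thesis using assms by (auto simp: pq_state_def pq_next_state_def algebra_simps)
qed

lemma pq_next_state_prev:
  assumes "pq_next_state i P Q" "wronskian Q A = smult (of_int (3 * i + 1)) P"
    and "lead_coeff A = 1" "int (degree A) + int (degree Q) = int (degree P) + 1"
  shows "pq_state i P A"
proof -
  have "limit_of_simple P A"
    using limit_of_simple_step_q(2)[OF _ wronskian_commute_smult[OF assms(2)]] assms(1) linear_coeff_nonzero(1)[of i]
    by (metis neg_equal_0_iff_equal of_int_eq_0_iff pq_next_state_def)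
  then show ?thesis using assms by (auto simp: pq_state_def pq_next_state_def algebra_simps)
qed

lemma pq_next_state_step:
  assumes "pq_next_state i P Q" "wronskian A P = smult (of_int (6 * (i + 1) - 1)) (Q ^ 4)"
    and "lead_coeff A = 1" "int (degree A) + int (degree P) = 4 * int (degree Q) + 1"
  shows "pq_state (i + 1) A Q"
proof -
  have "limit_of_simple A Q"
    using limit_of_simple_step_p(2)[OF _ assms(2)] assms(1) linear_coeff_nonzero(2)[of "i + 1"]
    by (metis of_int_eq_0_iff pq_next_state_def)
  then show ?thesis using assms by (auto simp: pq_state_def pq_next_state_def algebra_simps)
qed

lemma pq_state_step_back:
  assumes "pq_state i P Q" "wronskian P A = smult (of_int (6 * i - 1)) (Q ^ 4)"
    and "lead_coeff A = 1" "int (degree A) + int (degree P) = 4 * int (degree Q) + 1"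
  shows "pq_next_state (i - 1) A Q"
proof -
  have "limit_of_simple A Q"
    using limit_of_simple_step_p(2)[OF _ wronskian_commute_smult[OF assms(2)]] assms(1) linear_coeff_nonzero(2)[of i]
    by (metis neg_equal_0_iff_equal of_int_eq_0_iff pq_state_def)
  then show ?thesis using assms by (auto simp: pq_state_def pq_next_state_def algebra_simps)
qed

lemma lead_coeff_power4: "lead_coeff (Q :: complex poly) = 1 \<Longrightarrow> lead_coeff (Q ^ 4) = 1"
  by (simp add: lead_coeff_power)

lemma degree_power4: "degree ((Q :: complex poly) ^ 4) = 4 * degree Q"
  by (cases "Q = 0") (simp_all add: degree_power_eq)

text \<open>Existence holds for every integer \<open>i\<close>. For negative \<open>i\<close> the
  step leads towards index 0 and \<open>A\<close> has smaller degree than \<open>Q\<close>, so it is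
  a particular choice: adding a multiple of \<open>Q\<close> would spoil the degree.\<close>

lemma ex_pq_state_next:
  assumes "pq_state i P Q"
  shows "\<exists>A. pq_next_state i P A \<and> wronskian A Q = smult (of_int (3 * i + 1)) P"
proof -
  from assms have g: "limit_of_simple P Q" and lc: "lead_coeff P = 1" "lead_coeff Q = 1"
    and deg: "int (degree P) = i * (3 * i + 2)" "2 * int (degree Q) = i * (3 * i - 1)"
    by (auto simp: pq_state_def)
  obtain A0 where "wronskian A0 Q = P" using limit_of_simple_step_q(1)[OF g] by blast
  from wronskian_monic_solution[OF this lc(2,1)] obtain A where A: "lead_coeff A = 1"
      "int (degree A) + int (degree Q) = int (degree P) + 1"
      "wronskian A Q = smult (of_int (int (degree A) - int (degree Q))) P" by blast
  have "int (degree A) - int (degree Q) = 3 * i + 1"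
    using A(2) deg by (simp add: algebra_simps)
  then show ?thesis using A pq_state_next[OF assms] by metis
qed

lemma ex_pq_next_state_prev:
  assumes "pq_next_state i P Q"
  shows "\<exists>A. pq_state i P A \<and> wronskian Q A = smult (of_int (3 * i + 1)) P"
proof -
  from assms have g: "limit_of_simple P Q" and lc: "lead_coeff P = 1" "lead_coeff Q = 1"
    and deg: "int (degree P) = i * (3 * i + 2)" "2 * int (degree Q) = (i + 1) * (3 * i + 2)"
    by (auto simp: pq_next_state_def)
  obtain A0 where "wronskian A0 Q = P" using limit_of_simple_step_q(1)[OF g] by blast
  from wronskian_monic_solution[OF this lc(2,1)] obtain A where A: "lead_coeff A = 1"
      "int (degree A) + int (degree Q) = int (degree P) + 1"
      "wronskian A Q = smult (of_int (int (degree A) - int (degree Q))) P" by blast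
  have "int (degree A) - int (degree Q) = - (3 * i + 1)"
    using A(2) deg by (simp add: algebra_simps)
  then have "wronskian Q A = smult (of_int (3 * i + 1)) P"
    using wronskian_commute_smult[OF A(3)] by (simp add: add.commute)
  then show ?thesis using A pq_next_state_prev[OF assms] by metis
qed

lemma ex_pq_next_state_step:
  assumes "pq_next_state i P Q"
  shows "\<exists>A. pq_state (i + 1) A Q \<and> wronskian A P = smult (of_int (6 * (i + 1) - 1)) (Q ^ 4)"
proof -
  from assms have g: "limit_of_simple P Q" and lc: "lead_coeff P = 1" "lead_coeff Q = 1"
    and deg: "int (degree P) = i * (3 * i + 2)" "2 * int (degree Q) = (i + 1) * (3 * i + 2)"
    by (auto simp: pq_next_state_def)
  obtain A0 where "wronskian A0 P = Q ^ 4" using limit_of_simple_step_p(1)[OF g] by blast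
  from wronskian_monic_solution[OF this lc(1) lead_coeff_power4[OF lc(2)]] obtain A
    where A: "lead_coeff A = 1" "int (degree A) + int (degree P) = 4 * int (degree Q) + 1"
      "wronskian A P = smult (of_int (int (degree A) - int (degree P))) (Q ^ 4)"
    unfolding degree_power4 by auto
  have "int (degree A) - int (degree P) = 6 * (i + 1) - 1"
    using A(2) deg by (simp add: algebra_simps)
  then show ?thesis using A pq_next_state_step[OF assms] by metis
qed

lemma ex_pq_state_step_back:
  assumes "pq_state i P Q"
  shows "\<exists>A. pq_next_state (i - 1) A Q \<and> wronskian P A = smult (of_int (6 * i - 1)) (Q ^ 4)"
proof -
  from assms have g: "limit_of_simple P Q" and lc: "lead_coeff P = 1" "lead_coeff Q = 1"
    and deg: "int (degree P) = i * (3 * i + 2)" "2 * int (degree Q) = i * (3 * i - 1)"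
    by (auto simp: pq_state_def)
  obtain A0 where "wronskian A0 P = Q ^ 4" using limit_of_simple_step_p(1)[OF g] by blast
  from wronskian_monic_solution[OF this lc(1) lead_coeff_power4[OF lc(2)]] obtain A
    where A: "lead_coeff A = 1" "int (degree A) + int (degree P) = 4 * int (degree Q) + 1"
      "wronskian A P = smult (of_int (int (degree A) - int (degree P))) (Q ^ 4)"
    unfolding degree_power4 by auto
  have "int (degree A) - int (degree P) = - (6 * i - 1)"
    using A(2) deg by (simp add: algebra_simps)
  then have "wronskian P A = smult (of_int (6 * i - 1)) (Q ^ 4)"
    using wronskian_commute_smult[OF A(3)] by (simp add: add.commute)
  then show ?thesis using A pq_state_step_back[OF assms] by metis
qed

text \<open>
  Moving away from the initial values, the second solution has the larger degree, so the
  integration constant affects neither the degree nor the leading coefficient.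
\<close>

lemma pq_state_next_any:
  assumes "pq_state i P Q" "0 \<le> i" "wronskian A Q = smult (of_int (3 * i + 1)) P"
  shows "pq_next_state i P A"
proof -
  from assms have lc: "lead_coeff P = 1" "lead_coeff Q = 1"
    and deg: "int (degree P) = i * (3 * i + 2)" "2 * int (degree Q) = i * (3 * i - 1)"
    by (auto simp: pq_state_def)
  have c: "of_int (3 * i + 1) \<noteq> (0 :: complex)" using linear_coeff_nonzero(1) of_int_eq_0_iff by blast
  have "2 * int (degree Q) < int (degree P) + 2"
    unfolding deg using assms(2) by (simp add: algebra_simps)
  note * = wronskian_solution_degree[OF assms(3) c lc(2,1) this]
  have "int (degree A) - int (degree Q) = 3 * i + 1"
    using *(1) deg by (simp add: algebra_simps)
  with *(2) have "lead_coeff A = 1" using linear_coeff_nonzero(1) lead_coeff_eq_one by metis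
  then show ?thesis using pq_state_next[OF assms(1,3)] *(1) by blast
qed

lemma pq_next_state_prev_any:
  assumes "pq_next_state i P Q" "i < 0" "wronskian Q A = smult (of_int (3 * i + 1)) P"
  shows "pq_state i P A"
proof -
  from assms have lc: "lead_coeff P = 1" "lead_coeff Q = 1"
    and deg: "int (degree P) = i * (3 * i + 2)" "2 * int (degree Q) = (i + 1) * (3 * i + 2)"
    by (auto simp: pq_next_state_def)
  have c: "of_int (- (3 * i + 1)) \<noteq> (0 :: complex)"
    using linear_coeff_nonzero(1) of_int_eq_0_iff neg_equal_0_iff_equal by metis
  note W = wronskian_commute_smult[OF assms(3)]
  \<comment> \<open>After expansion this is \<open>3 * i < 0\<close>. For \<open>i = 0\<close> the
    step would lead from \<open>q_1\<close> back to \<open>q_0\<close>, towards the initial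
    values.\<close>
  have "2 * int (degree Q) < int (degree P) + 2"
    unfolding deg using assms(2) by (simp add: algebra_simps)
  note * = wronskian_solution_degree[OF W c lc(2,1) this]
  have "int (degree A) - int (degree Q) = - (3 * i + 1)"
    using *(1) deg by (simp add: algebra_simps)
  with *(2) have "lead_coeff A = 1"
    using linear_coeff_nonzero(1) lead_coeff_eq_one neg_equal_0_iff_equal by metis
  then show ?thesis using pq_next_state_prev[OF assms(1,3)] *(1) by blast
qed

lemma pq_next_state_step_any:
  assumes "pq_next_state i P Q" "0 \<le> i" "wronskian A P = smult (of_int (6 * (i + 1) - 1)) (Q ^ 4)"
  shows "pq_state (i + 1) A Q"
proof -
  from assms have lc: "lead_coeff P = 1" "lead_coeff Q = 1"
    and deg: "int (degree P) = i * (3 * i + 2)" "2 * int (degree Q) = (i + 1) * (3 * i + 2)"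
    by (auto simp: pq_next_state_def)
  have c: "of_int (6 * (i + 1) - 1) \<noteq> (0 :: complex)"
    using linear_coeff_nonzero(2) of_int_eq_0_iff by blast
  have "4 * int (degree Q) = 2 * ((i + 1) * (3 * i + 2))" using deg(2) by simp
  then have "2 * int (degree P) < int (degree (Q ^ 4)) + 2"
    unfolding degree_power4 using assms(2) deg(1) by (simp add: algebra_simps)
  note * = wronskian_solution_degree[OF assms(3) c lc(1) lead_coeff_power4[OF lc(2)] this,
      unfolded degree_power4]
  have "int (degree A) - int (degree P) = 6 * (i + 1) - 1"
    using *(1) deg by (simp add: algebra_simps)
  with *(2) have "lead_coeff A = 1" using linear_coeff_nonzero(2) lead_coeff_eq_one by metis
  then show ?thesis using pq_next_state_step[OF assms(1,3)] *(1) by simp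
qed

lemma pq_state_step_back_any:
  assumes "pq_state i P Q" "i \<le> 0" "wronskian P A = smult (of_int (6 * i - 1)) (Q ^ 4)"
  shows "pq_next_state (i - 1) A Q"
proof -
  from assms have lc: "lead_coeff P = 1" "lead_coeff Q = 1"
    and deg: "int (degree P) = i * (3 * i + 2)" "2 * int (degree Q) = i * (3 * i - 1)"
    by (auto simp: pq_state_def)
  have c: "of_int (- (6 * i - 1)) \<noteq> (0 :: complex)"
    using linear_coeff_nonzero(2) of_int_eq_0_iff neg_equal_0_iff_equal by metis
  note W = wronskian_commute_smult[OF assms(3)]
  have "4 * int (degree Q) = 2 * (i * (3 * i - 1))" using deg(2) by simp
  then have "2 * int (degree P) < int (degree (Q ^ 4)) + 2"
    unfolding degree_power4 using assms(2) deg(1) by (simp add: algebra_simps)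
  note * = wronskian_solution_degree[OF W c lc(1) lead_coeff_power4[OF lc(2)] this,
      unfolded degree_power4]
  have "int (degree A) - int (degree P) = - (6 * i - 1)"
    using *(1) deg by (simp add: algebra_simps)
  with *(2) have "lead_coeff A = 1"
    using linear_coeff_nonzero(2) lead_coeff_eq_one neg_equal_0_iff_equal by metis
  then show ?thesis using pq_state_step_back[OF assms(1,3)] *(1) by simp
qed

text \<open>Two adjacent states are prescribed, not one, so that a sequence can be led through a
  pair \<open>(p_i, q_{i+1})\<close>, which straddles two states.\<close>

lemma two_sided_dependent_choice:
  fixes St :: "int \<Rightarrow> 'a \<Rightarrow> bool" and R :: "int \<Rightarrow> 'a \<Rightarrow> 'a \<Rightarrow> bool"
  assumes up: "\<And>i s. St i s \<Longrightarrow> \<exists>s'. St (i + 1) s' \<and> R i s s'"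
    and down: "\<And>i s. St i s \<Longrightarrow> \<exists>s'. St (i - 1) s' \<and> R (i - 1) s' s"
    and start: "St i s" "St (i + 1) s'" "R i s s'"
  shows "\<exists>f. f i = s \<and> f (i + 1) = s' \<and> (\<forall>j. St j (f j) \<and> R j (f j) (f (j + 1)))"
proof -
  \<comment> \<open>The conjunct for \<open>n = 0\<close> carries the prescribed start through the
    dependent choice, which only asserts that some first element exists.\<close>
  have "\<exists>u. \<forall>n. (St (i + 1 + int n) (u n) \<and> (n = 0 \<longrightarrow> u n = s')) \<and>
      R (i + 1 + int n) (u n) (u (Suc n))"
  proof (rule dependent_nat_choice)
    show "\<exists>x. St (i + 1 + int 0) x \<and> (0 = 0 \<longrightarrow> x = s')" using start(2) by simp
  next
    fix x n
    assume "St (i + 1 + int n) x \<and> (n = 0 \<longrightarrow> x = s')"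
    then obtain y where "St (i + 1 + int n + 1) y" "R (i + 1 + int n) x y" using up by blast
    moreover have "i + 1 + int n + 1 = i + 1 + int (Suc n)" by simp
    ultimately show "\<exists>y. (St (i + 1 + int (Suc n)) y \<and> (Suc n = 0 \<longrightarrow> y = s')) \<and> R (i + 1 + int n) x y"
      by auto
  qed
  then obtain u where u: "\<And>n. St (i + 1 + int n) (u n) \<and> (n = 0 \<longrightarrow> u n = s')"
      "\<And>n. R (i + 1 + int n) (u n) (u (Suc n))" by blast
  have "\<exists>d. \<forall>n. (St (i - int n) (d n) \<and> (n = 0 \<longrightarrow> d n = s)) \<and> R (i - int n - 1) (d (Suc n)) (d n)"
  proof (rule dependent_nat_choice)
    show "\<exists>x. St (i - int 0) x \<and> (0 = 0 \<longrightarrow> x = s)" using start(1) by simp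
  next
    fix x n
    assume "St (i - int n) x \<and> (n = 0 \<longrightarrow> x = s)"
    then obtain y where "St (i - int n - 1) y" "R (i - int n - 1) y x" using down by blast
    moreover have "i - int n - 1 = i - int (Suc n)" by simp
    ultimately show "\<exists>y. (St (i - int (Suc n)) y \<and> (Suc n = 0 \<longrightarrow> y = s)) \<and> R (i - int n - 1) y x"
      by (metis nat.distinct(1))
  qed
  then obtain d where d: "\<And>n. St (i - int n) (d n) \<and> (n = 0 \<longrightarrow> d n = s)"
      "\<And>n. R (i - int n - 1) (d (Suc n)) (d n)" by blast
  define f where "f j = (if j \<le> i then d (nat (i - j)) else u (nat (j - i - 1)))" for j
  have "St j (f j)" for j
    using d(1)[of "nat (i - j)"] u(1)[of "nat (j - i - 1)"] by (auto simp: f_def)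
  moreover have "R j (f j) (f (j + 1))" for j
  proof -
    consider "j < i" | "j = i" | "i < j" by linarith
    then show ?thesis
    proof cases
      case 1
      then have "nat (i - j) = Suc (nat (i - (j + 1)))" "i - int (nat (i - (j + 1))) - 1 = j" by auto
      then show ?thesis using d(2)[of "nat (i - (j + 1))"] 1 by (simp add: f_def)
    next
      case 2
      then show ?thesis using d(1)[of 0] u(1)[of 0] start(3) by (simp add: f_def)
    next
      case 3
      then have "nat (j + 1 - i - 1) = Suc (nat (j - i - 1))" "i + 1 + int (nat (j - i - 1)) = j" by auto
      then show ?thesis using u(2)[of "nat (j - i - 1)"] 3 by (simp add: f_def)
    qed
  qed
  moreover have "f i = s" "f (i + 1) = s'" using d(1)[of 0] u(1)[of 0] by (simp_all add: f_def)
  ultimately show ?thesis by blast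
qed

text \<open>The recurrence for polynomials, with the second relation shifted by one so that both
  link \<open>i\<close> to \<open>i + 1\<close>.\<close>

definition chain :: "(int \<Rightarrow> complex poly) \<Rightarrow> (int \<Rightarrow> complex poly) \<Rightarrow> bool" where
  "chain p q \<longleftrightarrow>
     (\<forall>i. wronskian (q (i + 1)) (q i) = smult (of_int (3 * i + 1)) (p i) \<and>
          wronskian (p (i + 1)) (p i) = smult (of_int (6 * (i + 1) - 1)) (q (i + 1) ^ 4))"

definition pq_step :: "int \<Rightarrow> complex poly \<times> complex poly \<Rightarrow> complex poly \<times> complex poly \<Rightarrow> bool" where
  "pq_step i s s' \<longleftrightarrow> wronskian (snd s') (snd s) = smult (of_int (3 * i + 1)) (fst s) \<and>
     wronskian (fst s') (fst s) = smult (of_int (6 * (i + 1) - 1)) (snd s' ^ 4)"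

lemma chain_through_step:
  assumes "pq_state i (fst s) (snd s)" "pq_state (i + 1) (fst s') (snd s')" "pq_step i s s'"
  shows "\<exists>p q. chain p q \<and> (\<forall>j. pq_state j (p j) (q j)) \<and>
    (p i, q i) = s \<and> (p (i + 1), q (i + 1)) = s'"
proof -
  have "\<exists>f. f i = s \<and> f (i + 1) = s' \<and>
    (\<forall>j. pq_state j (fst (f j)) (snd (f j)) \<and> pq_step j (f j) (f (j + 1)))"
  proof (rule two_sided_dependent_choice[where St = "\<lambda>j s. pq_state j (fst s) (snd s)"])
    fix i and s :: "complex poly \<times> complex poly"
    assume s: "pq_state i (fst s) (snd s)"
    obtain Q where Q: "pq_next_state i (fst s) Q" "wronskian Q (snd s) = smult (of_int (3 * i + 1)) (fst s)"
      using ex_pq_state_next[OF s] by blast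
    obtain P where "pq_state (i + 1) P Q" "wronskian P (fst s) = smult (of_int (6 * (i + 1) - 1)) (Q ^ 4)"
      using ex_pq_next_state_step[OF Q(1)] by blast
    with Q show "\<exists>s'. pq_state (i + 1) (fst s') (snd s') \<and> pq_step i s s'"
      by (intro exI[of _ "(P, Q)"]) (simp add: pq_step_def)
  next
    fix i and s :: "complex poly \<times> complex poly"
    assume s: "pq_state i (fst s) (snd s)"
    obtain P where P: "pq_next_state (i - 1) P (snd s)"
        "wronskian (fst s) P = smult (of_int (6 * i - 1)) (snd s ^ 4)"
      using ex_pq_state_step_back[OF s] by blast
    obtain Q where "pq_state (i - 1) P Q" "wronskian (snd s) Q = smult (of_int (3 * (i - 1) + 1)) P"
      using ex_pq_next_state_prev[OF P(1)] by blast
    with P show "\<exists>s'. pq_state (i - 1) (fst s') (snd s') \<and> pq_step (i - 1) s' s"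
      by (intro exI[of _ "(P, Q)"]) (simp add: pq_step_def)
  qed (use assms in auto)
  then obtain f where "f i = s" "f (i + 1) = s'"
    "\<And>j. pq_state j (fst (f j)) (snd (f j)) \<and> pq_step j (f j) (f (j + 1))" by blast
  then show ?thesis
    by (intro exI[of _ "\<lambda>j. fst (f j)"] exI[of _ "\<lambda>j. snd (f j)"]) (auto simp: chain_def pq_step_def)
qed

lemma chain_through_pq_state:
  assumes "pq_state i P Q"
  shows "\<exists>p q. chain p q \<and> (\<forall>j. pq_state j (p j) (q j)) \<and> p i = P \<and> q i = Q"
proof -
  obtain Q' where Q': "pq_next_state i P Q'" "wronskian Q' Q = smult (of_int (3 * i + 1)) P"
    using ex_pq_state_next[OF assms] by blast
  obtain P' where "pq_state (i + 1) P' Q'" "wronskian P' P = smult (of_int (6 * (i + 1) - 1)) (Q' ^ 4)"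
    using ex_pq_next_state_step[OF Q'(1)] by blast
  then show ?thesis using chain_through_step[of i "(P, Q)" "(P', Q')"] assms Q'
    by (auto simp: pq_step_def)
qed

lemma chain_through_pq_next_state:
  assumes "pq_next_state i P Q"
  shows "\<exists>p q. chain p q \<and> (\<forall>j. pq_state j (p j) (q j)) \<and> p i = P \<and> q (i + 1) = Q"
proof -
  obtain Q' where "pq_state i P Q'" "wronskian Q Q' = smult (of_int (3 * i + 1)) P"
    using ex_pq_next_state_prev[OF assms] by blast
  moreover obtain P' where "pq_state (i + 1) P' Q" "wronskian P' P = smult (of_int (6 * (i + 1) - 1)) (Q ^ 4)"
    using ex_pq_next_state_step[OF assms] by blast
  ultimately show ?thesis using chain_through_step[of i "(P, Q')" "(P', Q)"]
    by (auto simp: pq_step_def)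
qed

section \<open>Normalising a chain at index 0\<close>

lemma monic_constant: "degree (P :: complex poly) = 0 \<Longrightarrow> lead_coeff P = 1 \<Longrightarrow> P = 1"
  by (metis degree_0_id one_pCons)

lemma pq_state_0: "pq_state 0 P Q \<Longrightarrow> P = 1 \<and> Q = 1"
  by (auto simp: pq_state_def intro!: monic_constant)

text \<open>The recurrence links only neighbours, so chains that agree at index 0 can be exchanged
  there. The link from -1 to 0 comes from the second chain.\<close>

lemma chain_glue:
  assumes "chain p q" "chain p' q'" "p 0 = p' 0" "q 0 = q' 0"
  shows "chain (\<lambda>j. if j \<ge> 0 then p j else p' j) (\<lambda>j. if j \<ge> 0 then q j else q' j)"
  unfolding chain_def
proof
  fix i :: int
  consider "0 \<le> i" | "i = -1" | "i + 1 < 0" by linarith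
  then show "wronskian (if i + 1 \<ge> 0 then q (i + 1) else q' (i + 1)) (if i \<ge> 0 then q i else q' i)
        = smult (of_int (3 * i + 1)) (if i \<ge> 0 then p i else p' i) \<and>
      wronskian (if i + 1 \<ge> 0 then p (i + 1) else p' (i + 1)) (if i \<ge> 0 then p i else p' i)
        = smult (of_int (6 * (i + 1) - 1)) ((if i + 1 \<ge> 0 then q (i + 1) else q' (i + 1)) ^ 4)"
  proof cases
    case 1
    then show ?thesis using assms(1) by (simp add: chain_def)
  next
    case 2
    then show ?thesis using assms(2)[unfolded chain_def, rule_format, of "-1"] assms(3,4) by simp
  next
    case 3
    then show ?thesis using assms(2) by (simp add: chain_def)
  qed
qed

lemma monic_linear:
  assumes "degree (P :: complex poly) = 1" "lead_coeff P = 1"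
  shows "\<exists>c. P = [:c, 1:]"
proof -
  have "coeff P n = coeff [:coeff P 0, 1:] n" for n
    using assms by (cases n rule: nat.exhaust; cases "n - 1") (auto intro: coeff_eq_0)
  then show ?thesis by (metis poly_eqI)
qed

lemma limit_of_simple_linear: "limit_of_simple 1 [:c, 1:]" "limit_of_simple [:c, 1:] 1"
proof -
  have "no_multiple_or_common_roots 1 [:c, 1:]" "no_multiple_or_common_roots [:c, 1:] 1"
    by (auto simp: no_multiple_or_common_roots_def rsquarefree_roots pderiv_pCons)
  moreover have "bracket2 1 [:c, 1:] = 0" "bracket2 [:c, 1:] 1 = 0"
    by (auto simp: bracket2_def pderiv_pCons)
  ultimately show "limit_of_simple 1 [:c, 1:]" "limit_of_simple [:c, 1:] 1" by (auto intro: limit_of_simpleI)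
qed

text \<open>The constant \<open>c\<close> is read off from \<open>q 1\<close>; the lower half is
  replaced by one with the same constant in \<open>p (-1)\<close>, so that one translation
  normalises both.\<close>

lemma chain_start_up:
  assumes "chain p q" "\<And>j. pq_state j (p j) (q j)"
  shows "\<exists>c p' q'. chain p' q' \<and> p' (-1) = [:c, 1:] \<and> p' 0 = 1 \<and> q' 0 = 1 \<and> q' 1 = [:c, 1:] \<and>
    (\<forall>j\<ge>0. p' j = p j \<and> q' j = q j)"
proof -
  obtain c where c: "q 1 = [:c, 1:]"
    using monic_linear[of "q 1"] assms(2)[of 1] by (auto simp: pq_state_def)
  \<comment> \<open>\<open>p_{-1} = z + c\<close> together with \<open>q_0 = 1\<close> is a pair of
    the second kind at index -1, and the chain through it supplies the lower half.\<close>
  have "pq_next_state (-1) [:c, 1:] 1"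
    by (simp add: pq_next_state_def limit_of_simple_linear)
  then obtain p2 q2 where *: "chain p2 q2" "\<And>j. pq_state j (p2 j) (q2 j)" "p2 (-1) = [:c, 1:]"
    using chain_through_pq_next_state by blast
  note 0 = pq_state_0[OF assms(2)] pq_state_0[OF *(2)]
  show ?thesis
    using chain_glue[OF assms(1) *(1)] 0 c *(3)
    by (intro exI[of _ c] exI[of _ "\<lambda>j. if j \<ge> 0 then p j else p2 j"]
        exI[of _ "\<lambda>j. if j \<ge> 0 then q j else q2 j"]) auto
qed

lemma chain_start_down:
  assumes "chain p q" "\<And>j. pq_state j (p j) (q j)"
  shows "\<exists>c p' q'. chain p' q' \<and> p' (-1) = [:c, 1:] \<and> p' 0 = 1 \<and> q' 0 = 1 \<and> q' 1 = [:c, 1:] \<and>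
    (\<forall>j\<le>0. p' j = p j \<and> q' j = q j)"
proof -
  obtain c where c: "p (-1) = [:c, 1:]"
    using monic_linear[of "p (-1)"] assms(2)[of "-1"] by (auto simp: pq_state_def)
  \<comment> \<open>Here the upper half is rebuilt, from \<open>p_0 = 1\<close> and
    \<open>q_1 = z + c\<close>.\<close>
  have "pq_next_state 0 1 [:c, 1:]"
    by (simp add: pq_next_state_def limit_of_simple_linear)
  then obtain p2 q2 where *: "chain p2 q2" "\<And>j. pq_state j (p2 j) (q2 j)" "q2 (0 + 1) = [:c, 1:]"
    using chain_through_pq_next_state by blast
  note 0 = pq_state_0[OF assms(2)] pq_state_0[OF *(2)]
  show ?thesis
    using chain_glue[OF *(1) assms(1)] 0 c *(3)
    by (intro exI[of _ c] exI[of _ "\<lambda>j. if j \<ge> 0 then p2 j else p j"]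
        exI[of _ "\<lambda>j. if j \<ge> 0 then q2 j else q j"]) auto
qed

section \<open>The degree equation forced by the bracket\<close>

lemma coeff_pderiv2_mult_top:
  fixes p q :: "complex poly"
  assumes "degree p + degree q = Suc (Suc k)"
  shows "coeff (pderiv (pderiv p) * q) k
    = of_nat (degree p) * (of_nat (degree p) - 1) * lead_coeff p * lead_coeff q"
proof (cases "degree p \<le> 1")
  case True
  then have "pderiv (pderiv p) = 0" by (simp add: pderiv_eq_0_iff degree_pderiv)
  then show ?thesis using True by (cases "degree p") auto
next
  case False
  then obtain d where d: "degree p = Suc (Suc d)" by (metis One_nat_def not_less_eq_eq not0_implies_Suc le0)
  have "coeff (pderiv (pderiv p) * q) (d + degree q) = coeff (pderiv (pderiv p)) d * lead_coeff q"
    by (rule coeff_mult_top) (simp_all add: degree_pderiv d)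
  then show ?thesis using assms d by (simp add: coeff_pderiv algebra_simps)
qed

lemma coeff_pderiv_mult_pderiv_top:
  fixes p q :: "complex poly"
  assumes "degree p + degree q = Suc (Suc k)"
  shows "coeff (pderiv p * pderiv q) k
    = of_nat (degree p) * of_nat (degree q) * lead_coeff p * lead_coeff q"
proof (cases "degree p = 0 \<or> degree q = 0")
  case True
  then have "pderiv p = 0 \<or> pderiv q = 0" by (simp add: pderiv_eq_0_iff)
  then show ?thesis using True by auto
next
  case False
  then obtain d e where d: "degree p = Suc d" "degree q = Suc e" by (metis not0_implies_Suc)
  have "coeff (pderiv p * pderiv q) (d + e) = coeff (pderiv p) d * coeff (pderiv q) e"
    by (rule coeff_mult_top) (simp_all add: degree_pderiv d)
  then show ?thesis using assms d by (simp add: coeff_pderiv algebra_simps)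
qed

text \<open>This is the coefficient of the bracket at \<open>degree P + degree Q - 2\<close>. Pairs
  of total degree at most 1 have no such coefficient and satisfy the equation by inspection.\<close>

lemma bracket2_degrees:
  assumes "bracket2 P Q = 0" "P \<noteq> 0" "Q \<noteq> 0"
  defines "n \<equiv> int (degree P)" and "m \<equiv> int (degree Q)"
  shows "n * (n - 1) - 4 * n * m + 4 * m * (m - 1) = 0"
proof (cases "degree P + degree Q \<le> 1")
  case True
  then have "degree P = 0 \<and> degree Q = 0 \<or> degree P = 1 \<and> degree Q = 0 \<or> degree P = 0 \<and> degree Q = 1"
    by linarith
  then show ?thesis by (auto simp: n_def m_def)
next
  case False
  then obtain k where k: "degree P + degree Q = Suc (Suc k)"
    by (metis One_nat_def not_less_eq_eq not0_implies_Suc le0)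
  have k': "degree Q + degree P = Suc (Suc k)" using k by simp
  have eq: "bracket2 P Q = pderiv (pderiv P) * Q - smult 4 (pderiv P * pderiv Q)
      + smult 4 (pderiv (pderiv Q) * P)"
    by (simp add: bracket2_def numeral_poly mult.commute)
  have "0 = coeff (bracket2 P Q) k" using assms(1) by simp
  also have "\<dots> = of_int (n * (n - 1) - 4 * n * m + 4 * m * (m - 1)) * (lead_coeff P * lead_coeff Q)"
    unfolding eq coeff_add coeff_diff coeff_smult coeff_pderiv2_mult_top[OF k]
      coeff_pderiv2_mult_top[OF k'] coeff_pderiv_mult_pderiv_top[OF k]
    by (simp add: n_def m_def algebra_simps)
  finally show ?thesis
    using assms(2,3) by (metis leading_coeff_0_iff mult_eq_0_iff of_int_eq_0_iff)
qed

text \<open>In terms of the total charge \<open>s = n - 2 * m\<close> the equation reads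
  \<open>6 * m = s * (s - 1)\<close>. The residue of \<open>s\<close> modulo 3 selects the case: 0
  gives the first kind of pair, 1 the second, and for 2 the right-hand side is not divisible by
  3.\<close>

lemma charge_degrees_cases:
  fixes n m :: int
  assumes "n * (n - 1) - 4 * n * m + 4 * m * (m - 1) = 0"
  shows "\<exists>i. n = i * (3 * i + 2) \<and>
    (2 * m = i * (3 * i - 1) \<or> 2 * m = (i + 1) * (3 * i + 2))"
proof -
  define s where "s = n - 2 * m"
  have 6: "6 * m = s * (s - 1)"
    using assms by (simp add: s_def algebra_simps power2_eq_square)
  have n: "n = s + 2 * m" by (simp add: s_def)
  obtain i r where s: "s = 3 * i + r" and r: "r = 0 \<or> r = 1 \<or> r = 2"
  proof -
    show thesis by (rule that[of "s div 3" "s mod 3"]) (simp, presburger)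
  qed
  from r consider "r = 0" | "r = 1" | "r = 2" by blast
  then show ?thesis
  proof cases
    case 1
    then have "2 * m = i * (3 * i - 1)" using 6 s by (simp add: algebra_simps)
    moreover from this have "n = i * (3 * i + 2)" using n s 1 by (simp add: algebra_simps)
    ultimately show ?thesis by blast
  next
    case 2
    \<comment> \<open>With this index \<open>s = - (3 * j + 2)\<close>, which turns
      \<open>s * (s - 1)\<close> into \<open>3 * (j + 1) * (3 * j + 2)\<close>.\<close>
    define j where "j = - i - 1"
    have m: "2 * m = (j + 1) * (3 * j + 2)" using 6 s 2 by (simp add: j_def algebra_simps)
    moreover from m have "n = j * (3 * j + 2)" using n s 2 by (simp add: j_def algebra_simps)
    ultimately show ?thesis by blast
  next
    case 3
    then have "6 * m = 3 * (3 * (i * i) + 3 * i) + 2" using 6 s by (simp add: algebra_simps)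
    moreover have "6 * x \<noteq> 3 * y + 2" for x y :: int by presburger
    ultimately show ?thesis by blast
  qed
qed

lemma limit_of_simple_cases:
  assumes "limit_of_simple P Q" "lead_coeff P = 1" "lead_coeff Q = 1"
  shows "\<exists>i. pq_state i P Q \<or> pq_next_state i P Q"
  using charge_degrees_cases[OF bracket2_degrees[OF limit_of_simple_bracket2[OF assms(1)] limit_of_simple_nonzero[OF assms(1)]]]
    assms by (auto simp: pq_state_def pq_next_state_def)

section \<open>Translation and the passage to solutions of the recurrence\<close>

lemma pcompose_power: "pcompose (p ^ n) r = pcompose p r ^ n" for p :: "complex poly"
  by (induction n) (simp_all add: pcompose_mult pcompose_1)

lemma wronskian_pcompose_linear: "wronskian (pcompose A [:c, 1:]) (pcompose B [:c, 1:]) = pcompose (wronskian A B) [:c, 1:]"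
  by (simp add: wronskian_def pderiv_pcompose pcompose_diff pcompose_mult pderiv_pCons)

lemma bracket2_pcompose_linear:
  "bracket2 (pcompose P [:c, 1:]) (pcompose Q [:c, 1:]) = pcompose (bracket2 P Q) [:c, 1:]"
  by (simp add: bracket2_def pderiv_pcompose pcompose_diff pcompose_add pcompose_mult pderiv_pCons
      numeral_poly pcompose_smult)

lemma chain_translate:
  assumes "chain p q"
  shows "chain (\<lambda>i. pcompose (p i) [:c, 1:]) (\<lambda>i. pcompose (q i) [:c, 1:])"
  using assms by (simp add: chain_def wronskian_pcompose_linear pcompose_smult pcompose_power)

lemma poly_deriv: "deriv (poly p) z = poly (pderiv p) z" for p :: "complex poly"
  by (rule DERIV_imp_deriv) (rule poly_DERIV)

lemma poly_wronskian: "poly (wronskian A B) z = deriv (poly A) z * poly B z - poly A z * deriv (poly B) z"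
  unfolding wronskian_def poly_deriv by simp

lemma poly_analytic_on: "poly (p :: complex poly) analytic_on S"
proof -
  have "poly p analytic_on UNIV"
    by (simp add: analytic_on_open poly_holomorphic_on[OF holomorphic_on_ident])
  then show ?thesis by (rule analytic_on_subset) simp
qed

lemma chain_rec_solution:
  assumes "chain p q" "p (-1) = [:0, 1:]" "p 0 = 1" "q 0 = 1" "q 1 = [:0, 1:]"
  shows "rec_solution (\<lambda>i. poly (p i)) (\<lambda>i. poly (q i))"
proof -
  have 1: "deriv (poly (q (i + 1))) z * poly (q i) z - poly (q (i + 1)) z * deriv (poly (q i)) z
      = of_int (3 * i + 1) * poly (p i) z" for i z
    using assms(1) unfolding poly_wronskian[symmetric] chain_def by simp
  have 2: "deriv (poly (p i)) z * poly (p (i - 1)) z - poly (p i) z * deriv (poly (p (i - 1))) z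
      = of_int (6 * i - 1) * poly (q i) z ^ 4" for i z
    using assms(1)[unfolded chain_def, rule_format, of "i - 1"] unfolding poly_wronskian[symmetric] by simp
  have 3: "poly (p i) nicely_meromorphic_on UNIV" for p :: "int \<Rightarrow> complex poly" and i
    by (intro analytic_on_imp_nicely_meromorphic_on poly_analytic_on)
  have 4: "poly (p (-1)) = (\<lambda>z. z)" "poly (p 0) = (\<lambda>z. 1)" "poly (q 0) = (\<lambda>z. 1)"
      "poly (q 1) = (\<lambda>z. z)"
    by (simp_all add: assms fun_eq_iff)
  show ?thesis unfolding rec_solution_def
    by (intro conjI allI 3 4 always_eventually 1 2)
qed

lemma simple_solution_pair_mod_translation:
  assumes "lead_coeff P = 1" "lead_coeff Q = 1" "no_multiple_or_common_roots P Q" "bracket2 P Q = 0"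
  shows "solution_pair_mod_translation P Q"
proof -
  have *: "solution_pair_mod_translation P Q"
    if "chain p q" "p (-1) = [:c, 1:]" "p 0 = 1" "q 0 = 1" "q 1 = [:c, 1:]"
      "P = p i" "Q = q i \<or> Q = q (i + 1)" for p q c i
  proof -
    have "rec_solution (\<lambda>i. poly (pcompose (p i) [:- c, 1:])) (\<lambda>i. poly (pcompose (q i) [:- c, 1:]))"
      by (rule chain_rec_solution[OF chain_translate[OF that(1)]])
         (simp_all add: that pcompose_pCons pcompose_1)
    then show ?thesis using that(6,7)
      unfolding solution_pair_mod_translation_def solution_pair_def by blast
  qed
  obtain i where i: "pq_state i P Q \<or> pq_next_state i P Q"
    using limit_of_simple_cases[OF limit_of_simpleI[OF assms(3,4)] assms(1,2)] by blast
  then obtain p q where pq: "chain p q" "\<And>j. pq_state j (p j) (q j)"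
      "P = p i" "Q = q i \<or> Q = q (i + 1)"
    using chain_through_pq_state chain_through_pq_next_state by metis
  show ?thesis
  \<comment> \<open>Both \<open>i\<close> and \<open>i + 1\<close> lie in the half that is kept: for
    negative \<open>i\<close> one still has \<open>i + 1 \<le> 0\<close>.\<close>
  proof (cases "0 \<le> i")
    case True
    obtain c p' q' where "chain p' q'" "p' (-1) = [:c, 1:]" "p' 0 = 1" "q' 0 = 1" "q' 1 = [:c, 1:]"
        "\<forall>j\<ge>0. p' j = p j \<and> q' j = q j"
      using chain_start_up[OF pq(1,2)] by blast
    with pq(3,4) show ?thesis using True by (intro *[of p' q' c i]) auto
  next
    case False
    obtain c p' q' where "chain p' q'" "p' (-1) = [:c, 1:]" "p' 0 = 1" "q' 0 = 1" "q' 1 = [:c, 1:]"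
        "\<forall>j\<le>0. p' j = p j \<and> q' j = q j"
      using chain_start_down[OF pq(1,2)] by blast
    with pq(3,4) show ?thesis using False by (intro *[of p' q' c i]) auto
  qed
qed

section \<open>Meromorphic solutions of the recurrence\<close>

lemma cosparse_poly_eq:
  fixes F G :: "complex poly"
  assumes "eventually (\<lambda>z. poly F z = poly G z) (cosparse UNIV)"
  shows "F = G"
proof (rule ccontr)
  assume "F \<noteq> G"
  then have "finite {z. poly (F - G) z = 0}" by (intro poly_roots_finite) simp
  moreover have "countable {z. poly F z \<noteq> poly G z}"
    using sparse_imp_countable[OF open_UNIV] assms by (simp add: eventually_cosparse)
  ultimately have "countable ({z. poly (F - G) z = 0} \<union> {z. poly F z \<noteq> poly G z})"
    by (metis countable_Un countable_finite)
  also have "{z. poly (F - G) z = 0} \<union> {z. poly F z \<noteq> poly G z} = UNIV" by auto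
  finally show False using uncountable_UNIV_complex by simp
qed

text \<open>One polynomial solution \<open>A0\<close> suffices to make all meromorphic solutions
  polynomial: \<open>(g - A0) / B\<close> has derivative 0 off a sparse set, whose complement is
  connected, so it is a constant.\<close>

lemma meromorphic_wronskian_solution:
  assumes g: "g nicely_meromorphic_on UNIV" and B: "B \<noteq> 0" and A0: "wronskian A0 B = F"
    and ev: "eventually (\<lambda>z. deriv g z * poly B z - g z * deriv (poly B) z = poly F z) (cosparse UNIV)"
  shows "\<exists>A. g = poly A \<and> wronskian A B = F"
proof -
  let ?R = "\<lambda>z. deriv g z * poly B z - g z * deriv (poly B) z = poly F z \<and> \<not> is_pole g z \<and> poly B z \<noteq> 0"
  have "eventually (\<lambda>z. \<not> is_pole g z) (cosparse UNIV)"
    using g by (intro meromorphic_on_imp_not_pole_cosparse) (simp add: nicely_meromorphic_on_def)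
  moreover have "eventually (\<lambda>z. z \<notin> {z. poly B z = 0}) (cosparse UNIV)"
    by (intro eventually_not_in_cosparse finite_imp_sparse poly_roots_finite B)
  ultimately have evR: "eventually ?R (cosparse UNIV)"
    using ev by eventually_elim auto
  define D where "D = UNIV - {z. \<not> ?R z}"
  have sp: "{z. \<not> ?R z} sparse_in UNIV" using evR by (simp add: eventually_cosparse)
  have "open D" unfolding D_def by (intro open_diff_sparse_pts sp) auto
  moreover have "connected D" unfolding D_def by (intro sparse_imp_connected sp) auto
  moreover have "((\<lambda>z. (g z - poly A0 z) / poly B z) has_field_derivative 0) (at z)" if "z \<in> D" for z
  proof -
    from that have z: "?R z" by (auto simp: D_def)
    then have "g analytic_on {z}"
      using nicely_meromorphic_on_imp_analytic_at[OF g] by simp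
    then have dg: "(g has_field_derivative deriv g z) (at z)"
      using analytic_on_imp_differentiable_at DERIV_deriv_iff_field_differentiable by blast
    have "poly F z = poly (pderiv A0) z * poly B z - poly A0 z * poly (pderiv B) z"
      by (simp add: A0[symmetric] wronskian_def)
    then have "(deriv g z - poly (pderiv A0) z) * poly B z - (g z - poly A0 z) * poly (pderiv B) z = 0"
      using z unfolding poly_deriv by (simp add: algebra_simps)
    moreover have "((\<lambda>z. (g z - poly A0 z) / poly B z) has_field_derivative
        ((deriv g z - poly (pderiv A0) z) * poly B z - (g z - poly A0 z) * poly (pderiv B) z)
        / (poly B z * poly B z)) (at z)"
      using z by (intro DERIV_divide DERIV_diff dg poly_DERIV) auto
    ultimately show ?thesis by simp
  qed
  ultimately have "(\<lambda>z. (g z - poly A0 z) / poly B z) constant_on D"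
    by (intro has_field_derivative_0_imp_constant_on)
  then obtain c where c: "\<And>z. z \<in> D \<Longrightarrow> (g z - poly A0 z) / poly B z = c"
    by (auto simp: constant_on_def)
  define A where "A = A0 + smult c B"
  have gA: "g z = poly A z" if "z \<in> D" for z
  proof -
    have "poly B z \<noteq> 0" using that by (simp add: D_def)
    then show ?thesis using c[OF that] by (simp add: A_def field_simps)
  qed
  have evA: "eventually (\<lambda>w. w \<in> D) (at z)" for z
    using eventually_cosparse_imp_eventually_at[OF evR] by (simp add: D_def)
  \<comment> \<open>At the exceptional points \<open>g\<close> has the finite limit of
    \<open>A\<close>, so it has no pole there, and being nicely meromorphic it takes that limit as
    its value.\<close>
  have "g z = poly A z" for z
  proof -
    have "(poly A \<longlongrightarrow> poly A z) (at z)" using poly_isCont isCont_def by blast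
    then have lim: "(g \<longlongrightarrow> poly A z) (at z)"
      by (rule Lim_transform_eventually) (use evA[of z] gA in \<open>auto elim: eventually_mono\<close>)
    then have "\<not> is_pole g z" using not_tendsto_and_filterlim_at_infinity is_pole_def by (metis at_neq_bot)
    then have "(g \<longlongrightarrow> g z) (at z)" using g by (auto simp: nicely_meromorphic_on_def)
    then show ?thesis using lim tendsto_unique[OF at_neq_bot] by blast
  qed
  moreover have "wronskian A B = F" by (simp add: A_def wronskian_add_left wronskian_smult_left A0)
  ultimately show ?thesis by auto
qed

lemma poly_power4: "poly ((Q :: complex poly) ^ 4) z = poly Q z ^ 4"
  by (rule poly_power)

lemma rec_solutionD:
  assumes "rec_solution p q"
  shows "p i nicely_meromorphic_on UNIV" "q i nicely_meromorphic_on UNIV"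
    and "eventually (\<lambda>z. deriv (q (i + 1)) z * q i z - q (i + 1) z * deriv (q i) z
                           = of_int (3 * i + 1) * p i z) (cosparse UNIV)"
    and "eventually (\<lambda>z. deriv (p i) z * p (i - 1) z - p i z * deriv (p (i - 1)) z
                           = of_int (6 * i - 1) * q i z ^ 4) (cosparse UNIV)"
  using assms unfolding rec_solution_def by blast+

lemma rec_solution_step_up:
  assumes rec: "rec_solution p q" and i: "0 \<le> i"
    and st: "p i = poly P" "q i = poly Q" "pq_state i P Q"
  shows "\<exists>P' Q'. p (i + 1) = poly P' \<and> q (i + 1) = poly Q' \<and> pq_state (i + 1) P' Q'"
proof -
  obtain A0 where "wronskian A0 Q = smult (of_int (3 * i + 1)) P"
    using ex_pq_state_next[OF st(3)] by blast
  moreover have "Q \<noteq> 0" using st(3) by (auto simp: pq_state_def)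
  moreover have "eventually (\<lambda>z. deriv (q (i + 1)) z * poly Q z - q (i + 1) z * deriv (poly Q) z
      = poly (smult (of_int (3 * i + 1)) P) z) (cosparse UNIV)"
    using rec_solutionD(3)[OF rec, of i] st(1,2) by simp
  ultimately obtain Q' where Q': "q (i + 1) = poly Q'" "wronskian Q' Q = smult (of_int (3 * i + 1)) P"
    using meromorphic_wronskian_solution[OF rec_solutionD(2)[OF rec]] by blast
  have st': "pq_next_state i P Q'" by (rule pq_state_next_any[OF st(3) i Q'(2)])
  obtain A0 where "wronskian A0 P = smult (of_int (6 * (i + 1) - 1)) (Q' ^ 4)"
    using ex_pq_next_state_step[OF st'] by blast
  moreover have "P \<noteq> 0" using st(3) by (auto simp: pq_state_def)
  moreover have "eventually (\<lambda>z. deriv (p (i + 1)) z * poly P z - p (i + 1) z * deriv (poly P) z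
      = poly (smult (of_int (6 * (i + 1) - 1)) (Q' ^ 4)) z) (cosparse UNIV)"
    using rec_solutionD(4)[OF rec, of "i + 1"] st(1) Q'(1) by (simp add: poly_power4)
  ultimately obtain P' where P': "p (i + 1) = poly P'" "wronskian P' P = smult (of_int (6 * (i + 1) - 1)) (Q' ^ 4)"
    using meromorphic_wronskian_solution[OF rec_solutionD(1)[OF rec]] by blast
  have "pq_state (i + 1) P' Q'" by (rule pq_next_state_step_any[OF st' i P'(2)])
  then show ?thesis using P'(1) Q'(1) by blast
qed

lemma rec_solution_step_down:
  assumes rec: "rec_solution p q" and i: "i \<le> 0"
    and st: "p i = poly P" "q i = poly Q" "pq_state i P Q"
  shows "\<exists>P' Q'. p (i - 1) = poly P' \<and> q (i - 1) = poly Q' \<and> pq_state (i - 1) P' Q'"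
proof -
  obtain A0 where "wronskian P A0 = smult (of_int (6 * i - 1)) (Q ^ 4)"
    using ex_pq_state_step_back[OF st(3)] by blast
  then have "wronskian A0 P = smult (of_int (- (6 * i - 1))) (Q ^ 4)" by (rule wronskian_commute_smult)
  moreover have "P \<noteq> 0" using st(3) by (auto simp: pq_state_def)
  moreover have "eventually (\<lambda>z. deriv (p (i - 1)) z * poly P z - p (i - 1) z * deriv (poly P) z
      = poly (smult (of_int (- (6 * i - 1))) (Q ^ 4)) z) (cosparse UNIV)"
    using rec_solutionD(4)[OF rec, of i] unfolding st(1,2)
    by (rule eventually_mono) (simp add: poly_power4 algebra_simps)
  ultimately obtain P' where P': "p (i - 1) = poly P'" "wronskian P' P = smult (of_int (- (6 * i - 1))) (Q ^ 4)"
    using meromorphic_wronskian_solution[OF rec_solutionD(1)[OF rec]] by blast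
  have st': "pq_next_state (i - 1) P' Q"
    using pq_state_step_back_any[OF st(3) i] wronskian_commute_smult[OF P'(2)] by simp
  obtain A0 where "wronskian Q A0 = smult (of_int (3 * (i - 1) + 1)) P'"
    using ex_pq_next_state_prev[OF st'] by blast
  then have "wronskian A0 Q = smult (of_int (- (3 * (i - 1) + 1))) P'" by (rule wronskian_commute_smult)
  moreover have "Q \<noteq> 0" using st(3) by (auto simp: pq_state_def)
  moreover have "eventually (\<lambda>z. deriv (q (i - 1)) z * poly Q z - q (i - 1) z * deriv (poly Q) z
      = poly (smult (of_int (- (3 * (i - 1) + 1))) P') z) (cosparse UNIV)"
    using rec_solutionD(3)[OF rec, of "i - 1"] unfolding P'(1) diff_add_cancel st(2)
    by (rule eventually_mono) (simp add: algebra_simps)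
  ultimately obtain Q' where Q': "q (i - 1) = poly Q'" "wronskian Q' Q = smult (of_int (- (3 * (i - 1) + 1))) P'"
    using meromorphic_wronskian_solution[OF rec_solutionD(2)[OF rec]] by blast
  have "pq_state (i - 1) P' Q'"
  proof (rule pq_next_state_prev_any[OF st'])
    show "wronskian Q Q' = smult (of_int (3 * (i - 1) + 1)) P'"
      using wronskian_commute_smult[OF Q'(2)] by simp
  qed (use i in simp)
  then show ?thesis using P'(1) Q'(1) by blast
qed

lemma pq_state_start: "pq_state 0 1 1"
proof -
  have "limit_of_simple 1 1"
    by (rule limit_of_simpleI) (auto simp: no_multiple_or_common_roots_def rsquarefree_roots bracket2_def)
  then show ?thesis by (simp add: pq_state_def)
qed

text \<open>Two inductions leave index 0 in opposite directions, since arbitrary integration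
  constants are controlled only away from it.\<close>

lemma rec_solution_pq_state:
  assumes rec: "rec_solution p q"
  shows "\<exists>P Q. p i = poly P \<and> q i = poly Q \<and> pq_state i P Q"
proof -
  have "p 0 = poly 1" "q 0 = poly 1"
    using rec by (auto simp: rec_solution_def)
  then have start: "\<exists>P Q. p 0 = poly P \<and> q 0 = poly Q \<and> pq_state 0 P Q"
    using pq_state_start by blast
  have up: "\<exists>P Q. p (int n) = poly P \<and> q (int n) = poly Q \<and> pq_state (int n) P Q" for n
  proof (induction n)
    case 0
    show ?case using start by (metis minus_zero of_nat_0)
  next
    case (Suc n)
    then obtain P Q where "p (int n) = poly P" "q (int n) = poly Q" "pq_state (int n) P Q" by blast
    from rec_solution_step_up[OF rec _ this] show ?case by (simp add: add.commute)
  qed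
  have down: "\<exists>P Q. p (- int n) = poly P \<and> q (- int n) = poly Q \<and> pq_state (- int n) P Q" for n
  proof (induction n)
    case 0
    show ?case using start by (metis minus_zero of_nat_0)
  next
    case (Suc n)
    then obtain P Q where st: "p (- int n) = poly P" "q (- int n) = poly Q" "pq_state (- int n) P Q"
      by blast
    have "- int n - 1 = - int (Suc n)" by simp
    then show ?case using rec_solution_step_down[OF rec _ st] by (metis neg_le_0_iff_le of_nat_0_le_iff)
  qed
  show ?thesis by (cases i rule: int_cases2) (use up down in auto)
qed

lemma rec_solution_polys:
  assumes rec: "rec_solution p q"
  shows "\<exists>P Q. \<forall>i. p i = poly (P i) \<and> q i = poly (Q i) \<and> pq_state i (P i) (Q i) \<and>
    bracket2 (P i) (Q i) = 0 \<and> bracket2 (P i) (Q (i + 1)) = 0"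
proof -
  obtain P Q where PQ: "\<And>i. p i = poly (P i)" "\<And>i. q i = poly (Q i)" "\<And>i. pq_state i (P i) (Q i)"
    using rec_solution_pq_state[OF rec] by metis
  have br: "bracket2 (P i) (Q i) = 0" for i
    using PQ(3) limit_of_simple_bracket2 by (simp add: pq_state_def)
  have "wronskian (Q (i + 1)) (Q i) = smult (of_int (3 * i + 1)) (P i)" for i
    using rec_solutionD(3)[OF rec, of i] unfolding PQ(1,2) poly_wronskian[symmetric]
    by (intro cosparse_poly_eq) simp
  moreover have "Q i \<noteq> 0" for i using PQ(3)[of i] by (auto simp: pq_state_def)
  ultimately have "bracket2 (P i) (Q (i + 1)) = 0" for i using bracket2_wronskian_q[OF br] by blast
  then show ?thesis using PQ br by blast
qed

lemma solution_pair_bracket2: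
  assumes "solution_pair P Q"
  shows "bracket2 P Q = 0"
proof -
  obtain p q i where rec: "rec_solution p q"
    and *: "poly P = p i \<and> poly Q = q i \<or> poly P = p i \<and> poly Q = q (i + 1)"
    using assms by (auto simp: solution_pair_def)
  obtain P' Q' where "\<forall>i. p i = poly (P' i) \<and> q i = poly (Q' i) \<and> pq_state i (P' i) (Q' i) \<and>
    bracket2 (P' i) (Q' i) = 0 \<and> bracket2 (P' i) (Q' (i + 1)) = 0"
    using rec_solution_polys[OF rec] by blast
  with * show ?thesis by (metis poly_eq_poly_eq_iff)
qed

lemma pcompose_linear_eq_0: "pcompose P [:c, 1:] = 0 \<Longrightarrow> P = 0" for P :: "complex poly"
  by (erule pcompose_eq_0) simp

lemma solution_pair_mod_translation_bracket2:
  assumes "solution_pair_mod_translation P Q"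
  shows "bracket2 P Q = 0"
  using assms solution_pair_bracket2 bracket2_pcompose_linear pcompose_linear_eq_0
  unfolding solution_pair_mod_translation_def by metis

section \<open>Rational integrals\<close>

lemma has_field_derivative_quotient_wronskian:
  assumes "poly B z \<noteq> 0"
  shows "((\<lambda>w. poly A w / poly B w) has_field_derivative poly (wronskian A B) z / poly B z ^ 2) (at z)"
  using DERIV_divide[OF poly_DERIV[of A z] poly_DERIV[of B z] assms]
  by (simp add: wronskian_def power2_eq_square)

lemma rational_integralI:
  assumes "wronskian A B = F" "B \<noteq> 0"
  shows "rational_integral F (B ^ 2)"
  unfolding rational_integral_def
  using has_field_derivative_quotient_wronskian[of B _ A] assms by auto

text \<open>If \<open>B\<close> has order \<open>k\<close> at \<open>z\<close>, then
  \<open>A' * B\<close> has order at least \<open>k\<close>, while \<open>A * B'\<close> has order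
  exactly \<open>k - 1\<close>.\<close>

lemma order_wronskian_less:
  assumes "B \<noteq> 0" "poly B z = 0" "poly A z \<noteq> 0"
  shows "order z (wronskian A B) < order z B" and "wronskian A B \<noteq> 0"
proof -
  have k: "order z B \<noteq> 0" using assms by (simp add: order_root)
  have B': "pderiv B \<noteq> 0"
  proof
    assume "pderiv B = 0"
    then obtain c where "B = [:c:]" using pderiv_iszero by blast
    with assms show False by simp
  qed
  have A: "A \<noteq> 0" "order z A = 0" using assms(3) by (auto simp: order_root)
  have "order z B = Suc (order z (pderiv B))" by (rule order_pderiv[OF assms(1,2)])
  then have "order z (A * pderiv B) < order z B"
    using A B' by (simp add: order_mult)
  then have "\<not> [:- z, 1:] ^ order z B dvd A * pderiv B"
    using A B' by (simp add: order_divides del: mult_eq_0_iff) simp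
  moreover have "[:- z, 1:] ^ order z B dvd pderiv A * B"
    by (intro dvd_mult order_1)
  ultimately have "\<not> [:- z, 1:] ^ order z B dvd wronskian A B"
    unfolding wronskian_def by (metis dvd_diff_right_iff)
  then show "order z (wronskian A B) < order z B" and "wronskian A B \<noteq> 0"
    by (auto simp: order_divides)
qed

text \<open>The identity says \<open>(A / B)' = F / q^2\<close>. Induction on
  \<open>degree B\<close> cancels common roots of \<open>A\<close> and \<open>B\<close>. Once none
  is left, comparing orders at a root of \<open>B\<close> shows that it is a root of
  \<open>q\<close> and simple; conversely roots of \<open>q\<close> are roots of \<open>B\<close>,
  so \<open>B\<close> is a constant multiple of \<open>q\<close>.\<close>

lemma wronskian_of_quotient_identity:
  assumes "wronskian A B * q ^ 2 = F * B ^ 2" "B \<noteq> 0" "rsquarefree q"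
    and nc: "\<And>z. poly q z = 0 \<Longrightarrow> poly F z \<noteq> 0"
  shows "\<exists>A. wronskian A q = F"
  using assms(1,2)
proof (induction "degree B" arbitrary: A B rule: less_induct)
  case less
  note id = less.prems(1) and B = less.prems(2)
  have q: "q \<noteq> 0" using assms(3) by (rule rsquarefree_imp_nonzero)
  show ?case
  proof (cases "\<exists>a. poly A a = 0 \<and> poly B a = 0")
    case True
    then obtain a A1 B1 where AB: "A = [:- a, 1:] * A1" "B = [:- a, 1:] * B1"
      by (metis dvdE poly_eq_0_iff_dvd)
    have B1: "B1 \<noteq> 0" using AB(2) B by auto
    have "wronskian A B = [:- a, 1:] ^ 2 * wronskian A1 B1"
      unfolding AB wronskian_def pderiv_mult power2_eq_square by (simp only: ring_distribs mult_ac) simp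
    then have "[:- a, 1:] ^ 2 * (wronskian A1 B1 * q ^ 2) = [:- a, 1:] ^ 2 * (F * B1 ^ 2)"
      using id unfolding AB(2) power_mult_distrib by (simp only: mult_ac)
    moreover have "[:- a, 1:] ^ 2 \<noteq> 0" by simp
    ultimately have "wronskian A1 B1 * q ^ 2 = F * B1 ^ 2"
      using mult_left_cancel by blast
    moreover have "degree B1 < degree B"
      unfolding AB(2) using B1 by (subst degree_mult_eq) auto
    ultimately show ?thesis using less.hyps B1 by blast
  next
    case False
    have simple: "poly q z = 0 \<and> order z B = 1" if z: "poly B z = 0" for z
    proof -
      have A: "poly A z \<noteq> 0" using False z by blast
      note o = order_wronskian_less[OF B z A]
      have k: "order z B \<noteq> 0" using B z by (simp add: order_root)
      have nz: "wronskian A B * q ^ 2 \<noteq> 0" using o(2) q by simp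
      have F: "F \<noteq> 0" using nz id by auto
      have pw: "order z (r ^ 2) = 2 * order z r" if "r \<noteq> 0" for r :: "complex poly"
        using that by (simp add: power2_eq_square order_mult)
      have "order z (wronskian A B * q ^ 2) = order z (wronskian A B) + 2 * order z q"
        using nz pw[OF q] order_mult[OF nz, of z] by simp
      moreover have "order z (F * B ^ 2) = order z F + 2 * order z B"
        using nz pw[OF B] order_mult[of F "B ^ 2" z] id by auto
      ultimately have e: "order z (wronskian A B) + 2 * order z q = order z F + 2 * order z B"
        using id by simp
      have "order z q = 0 \<or> order z q = 1" using assms(3) by (auto simp: rsquarefree_def)
      then show ?thesis
      proof
        assume "order z q = 0"
        with e o(1) show ?thesis by simp
      next
        assume q1: "order z q = 1"
        then have qz: "poly q z = 0" using order_root[of q z] q by simp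
        then have "order z F = 0" using nc order_root[of F z] F by blast
        with e o(1) q1 k have "order z B = 1" by simp
        with qz show ?thesis by blast
      qed
    qed
    have "rsquarefree B"
      unfolding rsquarefree_def
    proof (intro conjI allI)
      fix a
      show "order a B = 0 \<or> order a B = 1"
        using simple[of a] order_0I[of B a] by blast
    qed (rule B)
    then have "B dvd q" using simple by (intro rsquarefree_dvd) auto
    moreover have "q dvd B"
    proof (rule rsquarefree_dvd[OF assms(3)])
      fix z assume z: "poly q z = 0"
      have "poly (wronskian A B * q ^ 2) z = 0" using z by (simp add: power2_eq_square)
      then have "poly F z * poly B z ^ 2 = 0" unfolding id by (simp add: power2_eq_square)
      then show "poly B z = 0" using nc[OF z] by simp
    qed
    ultimately obtain s t where st: "q = B * s" "B = q * t" by blast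
    then have "q * (t * s) = q * 1" by (simp add: mult_ac)
    then have "t dvd 1" using q by (metis dvd_triv_left mult_left_cancel)
    then obtain c where "t = [:c:]" using is_unit_polyE by blast
    then have c: "B = smult c q" using st(2) by simp
    have c0: "c \<noteq> 0" using c B by auto
    have "smult c (wronskian A q * q ^ 2) = smult c (smult c F * q ^ 2)"
      using id unfolding c wronskian_smult_right by (simp add: power2_eq_square mult_ac)
    then have "wronskian A q * q ^ 2 = smult c F * q ^ 2" using c0 by (metis smult_eq_iff)
    then have "wronskian A q = smult c F" using q by (metis mult_right_cancel power_not_zero)
    then have "wronskian (smult (1 / c) A) q = F" using c0 by (simp add: wronskian_smult_left)
    then show ?thesis by blast
  qed
qed

lemma rational_integral_imp_wronskian:
  assumes "rational_integral F (q ^ 2)" "rsquarefree q" "\<And>z. poly q z = 0 \<Longrightarrow> poly F z \<noteq> 0"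
  shows "\<exists>A. wronskian A q = F"
proof -
  obtain A B where B: "B \<noteq> 0"
    and d: "\<And>z. poly (q ^ 2) z \<noteq> 0 \<Longrightarrow> poly B z \<noteq> 0 \<Longrightarrow>
      ((\<lambda>w. poly A w / poly B w) has_field_derivative poly F z / poly (q ^ 2) z) (at z)"
    using assms(1) unfolding rational_integral_def by blast
  have q: "q \<noteq> 0" using assms(2) by (rule rsquarefree_imp_nonzero)
  \<comment> \<open>The derivatives can be compared only off the roots of \<open>q\<close> and
    \<open>B\<close>. The factor \<open>q * B\<close> makes the identity true everywhere and is
    cancelled afterwards.\<close>
  have "poly ((wronskian A B * q ^ 2 - F * B ^ 2) * (q * B)) z = 0" for z
  proof (cases "poly q z = 0 \<or> poly B z = 0")
    case False
    then have "poly (q ^ 2) z \<noteq> 0" "poly B z \<noteq> 0" by (auto simp: power2_eq_square)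
    from DERIV_unique[OF d[OF this] has_field_derivative_quotient_wronskian[OF this(2)]]
    have "poly F z * poly B z ^ 2 = poly (wronskian A B) z * poly (q ^ 2) z"
      using \<open>poly (q ^ 2) z \<noteq> 0\<close> \<open>poly B z \<noteq> 0\<close> by (simp add: divide_simps)
    then show ?thesis by (simp add: power2_eq_square)
  qed auto
  then have "(wronskian A B * q ^ 2 - F * B ^ 2) * (q * B) = 0"
    using poly_all_0_iff_0 by blast
  then have "wronskian A B * q ^ 2 = F * B ^ 2" using q B by simp
  then show ?thesis by (rule wronskian_of_quotient_identity[OF _ B assms(2,3)])
qed

text \<open>Converse of \<open>wronskian_solvable\<close>: at a root of \<open>B\<close>,
  \<open>F = - A * B'\<close> and \<open>F' = - A * B''\<close>.\<close>

lemma wronskian_imp_no_residue: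
  assumes "wronskian A B = F" "poly B z = 0"
  shows "poly (pderiv F) z * poly (pderiv B) z = poly F z * poly (pderiv (pderiv B)) z"
proof -
  have "poly F z = - poly A z * poly (pderiv B) z"
    unfolding assms(1)[symmetric] wronskian_def using assms(2) by simp
  moreover have "poly (pderiv F) z = - poly A z * poly (pderiv (pderiv B)) z"
    unfolding assms(1)[symmetric] pderiv_wronskian using assms(2) by simp
  ultimately show ?thesis by simp
qed

lemma poly_pderiv_power4:
  "poly (pderiv (Q ^ 4)) z = 4 * poly Q z ^ 3 * poly (pderiv Q) z" for Q :: "complex poly"
  by (simp add: pderiv_power numeral_poly)

lemma degree_bracket2_less:
  assumes "0 < degree P + degree Q"
  shows "degree (bracket2 P Q) < degree P + degree Q"
proof -
  have *: "degree (pderiv p * r) < degree P + degree Q"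
    if "degree p + degree r \<le> degree P + degree Q" for p r :: "complex poly"
  proof (cases "0 < degree p + degree r")
    case True
    then show ?thesis using degree_pderiv_mult_less[of p r] that by simp
  next
    case False
    then have "pderiv p = 0" by (simp add: pderiv_eq_0_iff)
    with assms show ?thesis by simp
  qed
  have eq: "bracket2 P Q = pderiv (pderiv P) * Q - smult 4 (pderiv P * pderiv Q)
      + smult 4 (pderiv (pderiv Q) * P)"
    by (simp add: bracket2_def numeral_poly mult.commute)
  show ?thesis unfolding eq
    by (intro degree_add_less degree_diff_less le_less_trans[OF degree_smult_le] *)
       (simp_all add: degree_pderiv)
qed

text \<open>Absence of residues makes the bracket vanish at all roots of \<open>P\<close> and
  \<open>Q\<close>. These are \<open>degree P + degree Q\<close> distinct points, more than the
  degree of the bracket allows; for constant \<open>P\<close> and \<open>Q\<close> it is 0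
  anyway.\<close>

lemma bracket2_eq_0I:
  assumes simple: "no_multiple_or_common_roots P Q"
    and "wronskian A Q = P" "wronskian C P = Q ^ 4"
  shows "bracket2 P Q = 0"
proof (rule ccontr)
  assume nz: "bracket2 P Q \<noteq> 0"
  note nD = no_multiple_or_common_rootsD[OF simple]
  have "rsquarefree (P * Q)"
    unfolding rsquarefree_roots
  proof (intro allI notI)
    fix z assume z: "poly (P * Q) z = 0 \<and> poly (pderiv (P * Q)) z = 0"
    then have "poly P z = 0 \<or> poly Q z = 0" by simp
    then show False using z nD(5-8)[of z] by (auto simp: pderiv_mult)
  qed
  then have dvd: "P * Q dvd bracket2 P Q"
  proof (rule rsquarefree_dvd)
    fix z assume "poly (P * Q) z = 0"
    then consider "poly P z = 0" | "poly Q z = 0" by auto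
    then show "poly (bracket2 P Q) z = 0"
    proof cases
      case 1
      then have "poly Q z ^ 3 * (poly (pderiv (pderiv P)) z * poly Q z - 4 * poly (pderiv P) z * poly (pderiv Q) z) = 0"
        using wronskian_imp_no_residue[OF assms(3) 1] unfolding poly_pderiv_power4
        by (auto simp: power4_eq_xxxx power3_eq_cube mult_ac)
      then show ?thesis using nD(5)[OF 1] 1 by (simp add: poly_bracket2)
    next
      case 2
      then show ?thesis using wronskian_imp_no_residue[OF assms(2) 2] by (simp add: poly_bracket2)
    qed
  qed
  have "degree P + degree Q \<le> degree (bracket2 P Q)"
    using dvd_imp_degree_le[OF dvd nz] nD(3,4) by (simp add: degree_mult_eq)
  then have "degree P + degree Q = 0" using degree_bracket2_less[of P Q] by linarith
  then have "pderiv P = 0" "pderiv Q = 0" by (simp_all add: pderiv_eq_0_iff)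
  with nz show False by (simp add: bracket2_def)
qed

lemma rational_integrals_iff_bracket2:
  assumes simple: "no_multiple_or_common_roots P Q"
  shows "rational_integral P (Q ^ 2) \<and> rational_integral (Q ^ 4) (P ^ 2) \<longleftrightarrow> bracket2 P Q = 0"
proof
  note nD = no_multiple_or_common_rootsD[OF simple]
  assume r: "rational_integral P (Q ^ 2) \<and> rational_integral (Q ^ 4) (P ^ 2)"
  have "\<exists>A. wronskian A Q = P"
    using r nD(2,6) by (intro rational_integral_imp_wronskian) auto
  moreover have "\<exists>C. wronskian C P = Q ^ 4"
    using r nD(1,5) by (intro rational_integral_imp_wronskian) auto
  ultimately show "bracket2 P Q = 0" using bracket2_eq_0I[OF simple] by blast
next
  note nD = no_multiple_or_common_rootsD[OF simple]
  assume "bracket2 P Q = 0"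
  then show "rational_integral P (Q ^ 2) \<and> rational_integral (Q ^ 4) (P ^ 2)"
    using wronskian_solvable_q[OF simple] wronskian_solvable_p[OF simple] rational_integralI nD(3,4) by blast
qed

section \<open>Equilibrium of charges\<close>

lemma poly_pderiv_prod_linear:
  assumes "finite S" "(x :: complex) \<notin> S"
  shows "poly (pderiv (\<Prod>a\<in>S. [:- a, 1:])) x = poly (\<Prod>a\<in>S. [:- a, 1:]) x * (\<Sum>a\<in>S. 1 / (x - a))"
  using assms
proof (induction S rule: finite_induct)
  case (insert b S)
  then show ?case by (simp add: pderiv_mult pderiv_pCons field_simps del: mult_pCons_left)
qed simp

lemma sum_inverse_roots:
  fixes p :: "complex poly"
  assumes "rsquarefree p" "poly p x \<noteq> 0"
  shows "(\<Sum>a | poly p a = 0. 1 / (x - a)) = poly (pderiv p) x / poly p x"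
proof -
  let ?R = "\<Prod>a | poly p a = 0. [:- a, 1:]"
  have p: "smult (lead_coeff p) ?R = p" by (rule complex_poly_decompose_rsquarefree[OF assms(1)])
  have fin: "finite {a. poly p a = 0}"
    using assms(1) by (intro poly_roots_finite rsquarefree_imp_nonzero)
  have px: "lead_coeff p * poly ?R x = poly p x"
    using arg_cong[OF p, of "\<lambda>r. poly r x"] by simp
  have "poly (pderiv p) x = lead_coeff p * poly (pderiv ?R) x"
    using arg_cong[OF p, of "\<lambda>r. poly (pderiv r) x"] by (simp add: pderiv_smult)
  also have "poly (pderiv ?R) x = poly ?R x * (\<Sum>a | poly p a = 0. 1 / (x - a))"
    using assms(2) by (intro poly_pderiv_prod_linear fin) simp
  finally have "poly (pderiv p) x = poly p x * (\<Sum>a | poly p a = 0. 1 / (x - a))"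
    by (simp only: px flip: mult.assoc)
  then show ?thesis using assms(2) by simp
qed

text \<open>Up to a constant \<open>p = (z - x) * R\<close>, so \<open>p'(x) = R(x)\<close> and
  \<open>p''(x) = 2 * R'(x)\<close>: the quotient is twice the logarithmic derivative of
  \<open>R\<close>.\<close>

lemma sum_inverse_other_roots:
  fixes p :: "complex poly"
  assumes "rsquarefree p" "poly p x = 0"
  shows "2 * (\<Sum>a\<in>{a. poly p a = 0} - {x}. 1 / (x - a))
    = poly (pderiv (pderiv p)) x / poly (pderiv p) x"
proof -
  define R where "R = (\<Prod>a\<in>{a. poly p a = 0} - {x}. [:- a, 1:])"
  have fin: "finite {a. poly p a = 0}"
    using assms(1) by (intro poly_roots_finite rsquarefree_imp_nonzero)
  have lc: "lead_coeff p \<noteq> 0" using rsquarefree_imp_nonzero[OF assms(1)] by simp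
  have "p = smult (lead_coeff p) (\<Prod>a | poly p a = 0. [:- a, 1:])"
    using complex_poly_decompose_rsquarefree[OF assms(1)] by simp
  also have "(\<Prod>a | poly p a = 0. [:- a, 1:]) = [:- x, 1:] * R"
    unfolding R_def using assms(2) by (intro prod.remove fin) auto
  finally have p: "p = smult (lead_coeff p) ([:- x, 1:] * R)" .
  have p': "pderiv p = smult (lead_coeff p) (R + [:- x, 1:] * pderiv R)"
    by (subst p) (simp add: pderiv_smult pderiv_mult pderiv_pCons add_ac del: mult_pCons_left)
  then have p'': "pderiv (pderiv p) = smult (lead_coeff p) (2 * pderiv R + [:- x, 1:] * pderiv (pderiv R))"
    by (simp add: pderiv_smult pderiv_mult pderiv_add pderiv_pCons del: mult_pCons_left)
  have Rx: "poly R x \<noteq> 0" using fin by (auto simp: R_def poly_prod)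
  have R': "poly (pderiv R) x = poly R x * (\<Sum>a\<in>{a. poly p a = 0} - {x}. 1 / (x - a))"
    unfolding R_def using fin by (intro poly_pderiv_prod_linear) auto
  have "poly (pderiv p) x = lead_coeff p * poly R x"
    by (subst p') simp
  moreover have "poly (pderiv (pderiv p)) x = lead_coeff p * (2 * poly (pderiv R) x)"
    by (subst p'') (simp flip: numeral_poly)
  ultimately show ?thesis using lc Rx R' by simp
qed

lemma rsquarefree_card_roots:
  fixes p :: "complex poly"
  assumes "rsquarefree p"
  shows "card {a. poly p a = 0} = degree p"
proof -
  have "degree p = degree (\<Prod>a | poly p a = 0. [:- a, 1:])"
    using complex_poly_decompose_rsquarefree[OF assms] rsquarefree_imp_nonzero[OF assms]
    by (metis degree_smult_eq leading_coeff_0_iff)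
  also have "\<dots> = card {a. poly p a = 0}"
    by (subst degree_prod_sum_eq) auto
  finally show ?thesis by simp
qed

text \<open>The function is the real part of a local complex logarithm. Computing in real
  coordinates avoids the choice of a branch.\<close>

lemma has_real_derivative_ln_cmod:
  assumes "u \<noteq> 0"
  shows "((\<lambda>t. ln (cmod (u + d * of_real t))) has_real_derivative Re (d / u)) (at 0)"
proof -
  have pos: "0 < (Re u)\<^sup>2 + (Im u)\<^sup>2" using assms by (simp add: complex_neq_0)
  define S where "S = (Re u)\<^sup>2 + (Im u)\<^sup>2"
  have S: "sqrt S * (sqrt S * 2) = S * 2" using pos by (simp add: S_def flip: mult.assoc)
  have "((\<lambda>t. ln (sqrt ((Re u + Re d * t)\<^sup>2 + (Im u + Im d * t)\<^sup>2))) has_real_derivative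
      Re (d / u)) (at 0)"
    using pos
    by (auto intro!: derivative_eq_intros simp: Re_divide divide_simps S[unfolded S_def])
       (simp_all add: algebra_simps)
  then show ?thesis by (simp add: cmod_def)
qed

text \<open>The directions \<open>d = 1\<close> and \<open>d = \<i>\<close> give the two partial
  derivatives, so both vanish once the complex force on the charge does.\<close>

lemma has_real_derivative_energy:
  assumes inj: "inj_on z {1..n + m}" and k: "k \<in> {1..n + m}"
  shows "((\<lambda>t. energy n m (z(k := z k + d * of_real t))) has_real_derivative
    charge n k * Re (d * (\<Sum>j\<in>{1..n + m} - {k}. of_real (charge n j) / (z k - z j)))) (at 0)"
proof -
  \<comment> \<open>The contribution of the pair of charges \<open>k\<close> and \<open>j\<close>.
    In the double sum \<open>k\<close> may be the smaller or the larger index, hence the two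
    conditional terms below.\<close>
  define X where "X j = charge n k * charge n j * Re (d / (z k - z j))" for j
  have *: "((\<lambda>t. charge n i * charge n j *
      ln (cmod ((z(k := z k + d * of_real t)) i - (z(k := z k + d * of_real t)) j)))
      has_real_derivative ((if i = k then X j else 0) + (if j = k then X i else 0))) (at 0)"
    if j: "j \<in> {1..n + m}" and i: "i \<in> {1..<j}" for i j
  proof -
    have "z i \<noteq> z j" using inj_onD[OF inj, of i j] i j by auto
    then have u: "z i - z j \<noteq> 0" by simp
    have ij: "i \<noteq> j" using i by simp
    consider "i = k" "j \<noteq> k" | "j = k" "i \<noteq> k" | "i \<noteq> k" "j \<noteq> k" using ij by blast
    then show ?thesis
    proof cases
      case 1
      then show ?thesis
        using DERIV_cmult[OF has_real_derivative_ln_cmod[OF u, of d], of "charge n i * charge n j"]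
        by (simp add: X_def algebra_simps)
    next
      case 2
      have "d / (z k - z i) = - d / (z i - z j)"
        using 2 by (metis minus_diff_eq minus_divide_divide)
      then show ?thesis
        using 2 DERIV_cmult[OF has_real_derivative_ln_cmod[OF u, of "- d"], of "charge n i * charge n j"]
        by (simp add: X_def algebra_simps)
    next
      case 3
      then show ?thesis by simp
    qed
  qed
  have "(\<Sum>j = 1..n + m. \<Sum>i = 1..<j. (if i = k then X j else 0) + (if j = k then X i else 0))
      = (\<Sum>j = 1..n + m. (if k < j then X j else 0)) + (\<Sum>j = 1..n + m. (if j = k then \<Sum>i = 1..<k. X i else 0))"
    using k by (subst sum.distrib[symmetric], intro sum.cong) (auto simp: sum.distrib)
  also have "\<dots> = (\<Sum>j\<in>{1..n + m} \<inter> {j. k < j}. X j) + (\<Sum>i = 1..<k. X i)"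
    using k by (simp add: sum.inter_restrict)
  also have "\<dots> = (\<Sum>j\<in>({1..n + m} \<inter> {j. k < j}) \<union> {1..<k}. X j)"
    by (rule sum.union_disjoint[symmetric]) auto
  also have "({1..n + m} \<inter> {j. k < j}) \<union> {1..<k} = {1..n + m} - {k}"
    using k by auto
  also have "(\<Sum>j\<in>{1..n + m} - {k}. X j)
      = charge n k * Re (d * (\<Sum>j\<in>{1..n + m} - {k}. of_real (charge n j) / (z k - z j)))"
    unfolding sum_distrib_left Re_sum X_def
  proof (intro sum.cong refl)
    fix j
    have "d * (of_real (charge n j) / (z k - z j)) = of_real (charge n j) * (d / (z k - z j))" by simp
    moreover have "Re (of_real c * w) = c * Re w" for c w by simp
    ultimately show "charge n k * charge n j * Re (d / (z k - z j))
        = charge n k * Re (d * (of_real (charge n j) / (z k - z j)))"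
      by (simp only: mult.assoc)
  qed
  finally have eq: "(\<Sum>j = 1..n + m. \<Sum>i = 1..<j. (if i = k then X j else 0) + (if j = k then X i else 0))
      = charge n k * Re (d * (\<Sum>j\<in>{1..n + m} - {k}. of_real (charge n j) / (z k - z j)))" .
  show ?thesis unfolding energy_def eq[symmetric]
    by (intro DERIV_sum *)
qed

text \<open>The force on a root of \<open>P\<close> is \<open>P'' / (2 * P') - 2 * Q' / Q\<close>,
  the bracket divided by \<open>2 * P' * Q\<close>. On a root of \<open>Q\<close> it is
  \<open>P' / P - Q'' / Q'\<close>, the bracket divided by \<open>- 4 * P * Q'\<close>.\<close>

lemma bracket2_critical_point:
  assumes br: "bracket2 P Q = 0" and simple: "no_multiple_or_common_roots P Q"
    and n: "n = degree P" and m: "m = degree Q"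
    and zP: "z ` {1..n} = {x. poly P x = 0}" and zQ: "z ` {n + 1..n + m} = {x. poly Q x = 0}"
  shows "critical_point (n + m) (energy n m) z"
proof -
  note nD = no_multiple_or_common_rootsD[OF simple]
  have un: "{1..n + m} = {1..n} \<union> {n + 1..n + m}" by auto
  \<comment> \<open>Simple roots are as many as the degree, so an enumeration by that many indices
    hits each root once.\<close>
  have injP: "inj_on z {1..n}"
  proof (rule eq_card_imp_inj_on)
    show "card (z ` {1..n}) = card {1..n}"
      unfolding zP rsquarefree_card_roots[OF nD(1)] n[symmetric] by simp
  qed simp
  have injQ: "inj_on z {n + 1..n + m}"
  proof (rule eq_card_imp_inj_on)
    show "card (z ` {n + 1..n + m}) = card {n + 1..n + m}"
      unfolding zQ rsquarefree_card_roots[OF nD(2)] m[symmetric] by simp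
  qed simp
  have disj: "z ` {1..n} \<inter> z ` {n + 1..n + m} = {}"
    unfolding zP zQ using nD(5) by auto
  have inj: "inj_on z {1..n + m}"
    unfolding un inj_on_Un using injP injQ disj by blast
  have force: "(\<Sum>j\<in>{1..n + m} - {k}. of_real (charge n j) / (z k - z j)) = 0"
    if k: "k \<in> {1..n + m}" for k
  proof (cases "k \<le> n")
    case True
    then have x: "poly P (z k) = 0" using zP k by auto
    have set: "{1..n + m} - {k} = ({1..n} - {k}) \<union> {n + 1..n + m}" using True by auto
    have "(\<Sum>j\<in>{1..n} - {k}. complex_of_real (charge n j) / (z k - z j))
        = (\<Sum>j\<in>{1..n} - {k}. 1 / (z k - z j))"
      by (intro sum.cong) (auto simp: charge_def)
    also have "\<dots> = (\<Sum>a\<in>z ` ({1..n} - {k}). 1 / (z k - a))"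
      by (subst sum.reindex) (auto intro: inj_on_subset[OF injP])
    also have "z ` ({1..n} - {k}) = {x. poly P x = 0} - {z k}"
      using inj_on_image_set_diff[OF injP, of "{1..n}" "{k}"] zP k True by simp
    finally have 1: "2 * (\<Sum>j\<in>{1..n} - {k}. complex_of_real (charge n j) / (z k - z j))
        = poly (pderiv (pderiv P)) (z k) / poly (pderiv P) (z k)"
      using sum_inverse_other_roots[OF nD(1) x] by simp
    have "(\<Sum>j\<in>{n + 1..n + m}. complex_of_real (charge n j) / (z k - z j))
        = (\<Sum>j\<in>{n + 1..n + m}. - 2 * (1 / (z k - z j)))"
      by (intro sum.cong) (auto simp: charge_def)
    also have "\<dots> = - 2 * (\<Sum>a\<in>z ` {n + 1..n + m}. 1 / (z k - a))"
      by (subst sum.reindex[OF injQ]) (simp add: sum_distrib_left)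
    finally have 2: "(\<Sum>j\<in>{n + 1..n + m}. complex_of_real (charge n j) / (z k - z j))
        = - 2 * (poly (pderiv Q) (z k) / poly Q (z k))"
      using sum_inverse_roots[OF nD(2) nD(5)[OF x]] unfolding zQ by simp
    have "2 * (\<Sum>j\<in>{1..n + m} - {k}. complex_of_real (charge n j) / (z k - z j))
        = poly (pderiv (pderiv P)) (z k) / poly (pderiv P) (z k)
          - 4 * (poly (pderiv Q) (z k) / poly Q (z k))"
      unfolding set by (subst sum.union_disjoint) (use 1 2 in \<open>auto simp: distrib_left\<close>)
    also have "\<dots> = 0"
      using poly_bracket2[of P Q "z k"] br x nD(5)[OF x] nD(7)[OF x] by (simp add: field_simps)
    finally show ?thesis by simp
  next
    case False
    then have kQ: "k \<in> {n + 1..n + m}" using k by auto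
    then have x: "poly Q (z k) = 0" using zQ by auto
    have set: "{1..n + m} - {k} = {1..n} \<union> ({n + 1..n + m} - {k})" using False by auto
    have "(\<Sum>j\<in>{n + 1..n + m} - {k}. complex_of_real (charge n j) / (z k - z j))
        = (\<Sum>j\<in>{n + 1..n + m} - {k}. - 2 * (1 / (z k - z j)))"
      by (intro sum.cong) (auto simp: charge_def)
    also have "\<dots> = - 2 * (\<Sum>a\<in>z ` ({n + 1..n + m} - {k}). 1 / (z k - a))"
      by (subst sum.reindex) (auto intro: inj_on_subset[OF injQ] simp: sum_distrib_left)
    also have "z ` ({n + 1..n + m} - {k}) = {x. poly Q x = 0} - {z k}"
      using inj_on_image_set_diff[OF injQ, of "{n + 1..n + m}" "{k}"] zQ kQ by simp
    finally have 1: "(\<Sum>j\<in>{n + 1..n + m} - {k}. complex_of_real (charge n j) / (z k - z j))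
        = - (poly (pderiv (pderiv Q)) (z k) / poly (pderiv Q) (z k))"
      using sum_inverse_other_roots[OF nD(2) x] by simp
    have "(\<Sum>j\<in>{1..n}. complex_of_real (charge n j) / (z k - z j)) = (\<Sum>j\<in>{1..n}. 1 / (z k - z j))"
      by (intro sum.cong) (auto simp: charge_def)
    also have "\<dots> = (\<Sum>a\<in>z ` {1..n}. 1 / (z k - a))"
      by (subst sum.reindex[OF injP]) simp
    finally have 2: "(\<Sum>j\<in>{1..n}. complex_of_real (charge n j) / (z k - z j))
        = poly (pderiv P) (z k) / poly P (z k)"
      using sum_inverse_roots[OF nD(1) nD(6)[OF x]] unfolding zP by simp
    have "(\<Sum>j\<in>{1..n + m} - {k}. complex_of_real (charge n j) / (z k - z j))
        = poly (pderiv P) (z k) / poly P (z k)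
          - poly (pderiv (pderiv Q)) (z k) / poly (pderiv Q) (z k)"
      unfolding set by (subst sum.union_disjoint) (use 1 2 in auto)
    also have "\<dots> = 0"
      using poly_bracket2[of P Q "z k"] br x nD(6)[OF x] nD(8)[OF x] by (simp add: field_simps)
    finally show ?thesis .
  qed
  show ?thesis unfolding critical_point_def
  proof (intro conjI ballI inj)
    fix k assume k: "k \<in> {1..n + m}"
    show "((\<lambda>t. energy n m (z(k := z k + of_real t))) has_real_derivative 0) (at 0)"
      using has_real_derivative_energy[OF inj k, of 1] unfolding force[OF k] by simp
    show "((\<lambda>t. energy n m (z(k := z k + \<i> * of_real t))) has_real_derivative 0) (at 0)"
      using has_real_derivative_energy[OF inj k, of \<i>] unfolding force[OF k] by simp
  qed
qed

theorem proposition1: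
  "(\<forall>p q. rec_solution p q \<longrightarrow>
      (\<exists>P Q. \<forall>i. p i = poly (P i) \<and> q i = poly (Q i) \<and>
         int (degree (P i)) = i * (3 * i + 2) \<and>
         int (degree (Q i)) = i * (3 * i - 1) div 2))
   \<and>
   (\<forall>p q. rec_solution p q \<longrightarrow>
      (\<exists>P Q. \<forall>i. p i = poly (P i) \<and> q i = poly (Q i) \<and>
         bracket2 (P i) (Q i) = 0 \<and> bracket2 (P i) (Q (i + 1)) = 0))
   \<and>
   (\<forall>P Q. lead_coeff P = 1 \<longrightarrow> lead_coeff Q = 1 \<longrightarrow> no_multiple_or_common_roots P Q \<longrightarrow>
      bracket2 P Q = 0 \<longrightarrow> solution_pair_mod_translation P Q)
   \<and>
   (\<forall>P Q. lead_coeff P = 1 \<longrightarrow> lead_coeff Q = 1 \<longrightarrow> no_multiple_or_common_roots P Q \<longrightarrow>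
      (rational_integral P (Q ^ 2) \<and> rational_integral (Q ^ 4) (P ^ 2) \<longleftrightarrow> bracket2 P Q = 0) \<and>
      (bracket2 P Q = 0 \<longleftrightarrow> solution_pair_mod_translation P Q))
   \<and>
   (\<forall>P Q n m z. solution_pair P Q \<longrightarrow> no_multiple_or_common_roots P Q \<longrightarrow>
      n = degree P \<longrightarrow> m = degree Q \<longrightarrow>
      z ` {1..n} = {x. poly P x = 0} \<longrightarrow> z ` {n + 1..n + m} = {x. poly Q x = 0} \<longrightarrow>
      critical_point (n + m) (energy n m) z)"
proof (intro conjI allI impI)
  fix p q
  assume "rec_solution p q"
  from rec_solution_polys[OF this] obtain P Q
    where PQ: "\<And>i. p i = poly (P i) \<and> q i = poly (Q i) \<and> pq_state i (P i) (Q i)"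
    by blast
  have "int (degree (Q i)) = i * (3 * i - 1) div 2" for i
  proof -
    have "2 * int (degree (Q i)) = i * (3 * i - 1)" using PQ[of i] by (simp add: pq_state_def)
    then show ?thesis by linarith
  qed
  then show "\<exists>P Q. \<forall>i. p i = poly (P i) \<and> q i = poly (Q i) \<and>
      int (degree (P i)) = i * (3 * i + 2) \<and> int (degree (Q i)) = i * (3 * i - 1) div 2"
    using PQ by (intro exI[of _ P] exI[of _ Q]) (simp add: pq_state_def)
next
  fix p q
  assume "rec_solution p q"
  then show "\<exists>P Q. \<forall>i. p i = poly (P i) \<and> q i = poly (Q i) \<and>
      bracket2 (P i) (Q i) = 0 \<and> bracket2 (P i) (Q (i + 1)) = 0"
    using rec_solution_polys by blast
next
  fix P Q
  assume "lead_coeff P = 1" "lead_coeff Q = 1" "no_multiple_or_common_roots P Q" "bracket2 P Q = 0"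
  then show "solution_pair_mod_translation P Q"
    by (rule simple_solution_pair_mod_translation)
next
  fix P Q
  assume PQ: "lead_coeff P = 1" "lead_coeff Q = 1" "no_multiple_or_common_roots P Q"
  show "rational_integral P (Q ^ 2) \<and> rational_integral (Q ^ 4) (P ^ 2) \<longleftrightarrow> bracket2 P Q = 0"
    by (rule rational_integrals_iff_bracket2[OF PQ(3)])
  show "bracket2 P Q = 0 \<longleftrightarrow> solution_pair_mod_translation P Q"
    using simple_solution_pair_mod_translation[OF PQ] solution_pair_mod_translation_bracket2 by blast
next
  fix P Q n m z
  assume "solution_pair P Q" "no_multiple_or_common_roots P Q" "n = degree P" "m = degree Q"
    "z ` {1..n} = {x. poly P x = 0}" "z ` {n + 1..n + m} = {x. poly Q x = 0}"
  then show "critical_point (n + m) (energy n m) z"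
    using bracket2_critical_point[OF solution_pair_bracket2] by blast
qed

end
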